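(* Let $T$ be a countable set, $\alpha>0$, and let $\{X_t,t\in T\}$ be an associated $\alpha$-permanental process with kernel $\{u(s,t),s,t\in T\}$. For distinct $t_1,\dots,t_n\in T$ let $a_1(t_1,\dots,t_n),\dots,a_n(t_1,\dots,t_n)$ be the diagonal elements of $A(t_1,\dots,t_n)=\left(\{u(t_i,t_j)\}_{i,j=1}^n\right)^{-1}$, and let $a_i^*(t_1,\dots,t_n)$, $i=1,\dots,n$, denote a non-decreasing rearrangement of $a_i(t_1,\dots,t_n)$, $i=1,\dots,n$. For any integer $p\ge 1$ and $n\ge p$ let $$\psi^*_{[n/p]}=\inf_{(t_1,\dots,t_n)} a^*_{[n/p]}(t_1,\dots,t_n),$$ where the infimum is over all $n$-tuples of distinct elements of $T$ and $[\cdot]$ denotes integer part. Then for all $\lambda>0$, $$P\left(\sup_{t\in T}X_t\ge \lambda/\psi^*_{[n/p]}\right)\ \ge\ P\left(\max_{1\le i\le [n/p]}\xi^{(i)}_{\alpha,1}\ge\lambda\right),$$ where $\xi^{(1)}_{\alpha,1},\xi^{(2)}_{\alpha,1},\dots$ are independent copies of $\xi_{\alpha,1}$.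
   Context: For $\alpha>0$, an $\alpha$-permanental process with kernel $\{u(s,t),s,t\in T\}$ is a non-negative stochastic process $\{X_t,t\in T\}$ such that for all $t_1,\dots,t_n\in T$ and $s_1,\dots,s_n\ge 0$, $E\left(e^{-\sum_i s_iX_{t_i}}\right)=|I+KS|^{-\alpha}$ with $K=\{u(t_i,t_j)\}_{i,j=1}^n$, $S=\mathrm{diag}(s_1,\dots,s_n)$ and $|\cdot|$ the determinant. It is called an associated $\alpha$-permanental process if $u$ is the potential density of a transient Markov process with state space $T$; the process is taken to have local times $L^y_t$ normalized so that $u(x,y)=E^x(L^y_\infty)<\infty$. It is a known fact that for such $u$ an $\alpha$-permanental process with kernel $u$ exists for every $\alpha>0$, and that for distinct $t_1,\dots,t_n\in T$ the matrix $\{u(t_i,t_j)\}_{i,j=1}^n$ is invertible and its inverse is a nonsingular $M$-matrix (off-diagonal entries $\le 0$, inverse entrywise $\ge 0$). $\xi_{\alpha,1}$ denotes a gamma random variable with density $x^{\alpha-1}e^{-x}/\Gamma(\alpha)$ on $x>0$. Conventions: $\inf\emptyset=+\infty$, $\lambda/\infty=0$, $\lambda/0=\infty$. *)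

theory Defs
  imports
    "HOL-Probability.Probability"
    "Jordan_Normal_Form.Determinant"
    "Jordan_Normal_Form.Gauss_Jordan_Elimination"
begin

section \<open>Transient Markov processes with local times\<close>

text \<open>
  An optional time: a stopping time for the right-continuous filtration \<open>F\<^sub>t\<^sub>+\<close>. The value
  \<open>\<infinity>\<close> is allowed.
\<close>

definition optional_time :: "'w set \<Rightarrow> (real \<Rightarrow> 'w measure) \<Rightarrow> ('w \<Rightarrow> ennreal) \<Rightarrow> bool" where
  "optional_time \<Omega> F \<tau> \<longleftrightarrow> (\<forall>t\<ge>0. {\<omega>\<in>\<Omega>. \<tau> \<omega> < ennreal t} \<in> sets (F t))"

text \<open>
  A (Borel) right process with countable state space \<open>topspace S\<close>. The value \<open>None\<close> is the cemetery,
  \<open>\<theta> t\<close> are the shifts and \<open>P z\<close> is the law of the process started at \<open>z\<close>, a point of the state space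
  or the cemetery. In a countable metrizable space every set is Borel, so the measurable structure of
  the state space is discrete even when the topology is not, and \<open>z \<mapsto> P z B\<close> is automatically
  measurable. The \<open>\<sigma>\<close>-algebra \<open>G\<close> and the filtration \<open>F\<close> may, but need not, be the
  usual augmentation of the natural ones. Index values \<open>t < 0\<close> play no role.
\<close>

locale right_process = filtration "space G" F
  for G :: "'w measure" and F :: "real \<Rightarrow> 'w measure" +
  fixes S :: "'a topology"
    and Y :: "real \<Rightarrow> 'w \<Rightarrow> 'a option"
    and \<theta> :: "real \<Rightarrow> 'w \<Rightarrow> 'w"
    and P :: "'a option \<Rightarrow> 'w measure"
  assumes countable_state_space: "countable (topspace S)"
    and metrizable_state_space: "metrizable_space S"
    and sets_F: "\<And>t. sets (F t) \<subseteq> sets G"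
    and adapted: "\<And>t. 0 \<le> t \<Longrightarrow>
      Y t \<in> measurable (F t) (count_space (insert None (Some ` topspace S)))"
    and right_continuous: "\<And>\<omega> t x U.
      \<lbrakk>\<omega> \<in> space G; 0 \<le> t; Y t \<omega> = Some x; openin S U; x \<in> U\<rbrakk>
        \<Longrightarrow> \<forall>\<^sub>F s in at_right t. Y s \<omega> \<in> Some ` U"
    and absorbed: "\<And>\<omega> s t. \<lbrakk>\<omega> \<in> space G; 0 \<le> s; s \<le> t; Y s \<omega> = None\<rbrakk> \<Longrightarrow> Y t \<omega> = None"
    and shift_space: "\<And>\<omega> t. \<lbrakk>\<omega> \<in> space G; 0 \<le> t\<rbrakk> \<Longrightarrow> \<theta> t \<omega> \<in> space G"
    and shift: "\<And>\<omega> s t. \<lbrakk>\<omega> \<in> space G; 0 \<le> s; 0 \<le> t\<rbrakk> \<Longrightarrow> Y s (\<theta> t \<omega>) = Y (t + s) \<omega>"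
    and prob_space_P: "\<And>z. z \<in> insert None (Some ` topspace S) \<Longrightarrow> prob_space (P z)"
    and sets_P: "\<And>z. z \<in> insert None (Some ` topspace S) \<Longrightarrow> sets (P z) = sets G"
    and normal: "\<And>z. z \<in> insert None (Some ` topspace S) \<Longrightarrow> AE \<omega> in P z. Y 0 \<omega> = z"
    and shift_measurable: "\<And>\<tau>. optional_time (space G) F \<tau> \<Longrightarrow>
      (\<lambda>\<omega>. \<theta> (enn2real (\<tau> \<omega>)) \<omega>) \<in> measurable (restrict_space G {\<omega>. \<tau> \<omega> < \<infinity>}) G"
    \<comment> \<open>\<open>E\<^sup>z(H \<circ> \<theta>\<^sub>\<tau> | F\<^sub>\<tau>\<^sub>+) = E\<^bsup>Y(\<tau>)\<^esup>(H)\<close> on \<open>\<tau> < \<infinity>\<close>, with \<open>A\<close> ranging over \<open>F\<^sub>\<tau>\<^sub>+\<close>\<close>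
    and strong_Markov: "\<And>z \<tau> A (H :: 'w \<Rightarrow> ennreal).
      \<lbrakk>z \<in> insert None (Some ` topspace S); optional_time (space G) F \<tau>;
       A \<in> sets G; \<forall>t\<ge>0. {\<omega>\<in>A. \<tau> \<omega> < ennreal t} \<in> sets (F t);
       H \<in> borel_measurable G\<rbrakk>
        \<Longrightarrow> (\<integral>\<^sup>+\<omega>\<in>{\<omega>\<in>A. \<tau> \<omega> < \<infinity>}. H (\<theta> (enn2real (\<tau> \<omega>)) \<omega>) \<partial>P z)
          = (\<integral>\<^sup>+\<omega>\<in>{\<omega>\<in>A. \<tau> \<omega> < \<infinity>}. (\<integral>\<^sup>+\<omega>'. H \<omega>' \<partial>P (Y (enn2real (\<tau> \<omega>)) \<omega>)) \<partial>P z)"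
begin

text \<open>
  The last condition on paths says that the functional stays constant from the lifetime of the process
  onwards.
\<close>

definition continuous_additive_functional :: "(real \<Rightarrow> 'w \<Rightarrow> real) \<Rightarrow> bool" where
  "continuous_additive_functional A \<longleftrightarrow>
     (\<forall>t\<ge>0. A t \<in> borel_measurable (F t)) \<and>
     (\<forall>z \<in> insert None (Some ` topspace S). AE \<omega> in P z.
        A 0 \<omega> = 0 \<and>
        mono_on {0..} (\<lambda>t. A t \<omega>) \<and>
        continuous_on {0..} (\<lambda>t. A t \<omega>) \<and>
        (\<forall>s\<ge>0. \<forall>t\<ge>0. A (t + s) \<omega> = A t \<omega> + A s (\<theta> t \<omega>)) \<and>
        (\<forall>s\<ge>0. \<forall>t\<ge>s. Y s \<omega> = None \<longrightarrow> A t \<omega> = A s \<omega>))"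

definition first_increase :: "(real \<Rightarrow> 'w \<Rightarrow> real) \<Rightarrow> 'w \<Rightarrow> ennreal" where
  "first_increase A \<omega> = (INF t\<in>{t. 0 \<le> t \<and> 0 < A t \<omega>}. ennreal t)"

definition local_time :: "'a \<Rightarrow> (real \<Rightarrow> 'w \<Rightarrow> real) \<Rightarrow> bool" where
  "local_time y A \<longleftrightarrow>
     continuous_additive_functional A \<and>
     (AE \<omega> in P (Some y). first_increase A \<omega> = 0) \<and>
     (\<forall>x \<in> topspace S - {y}. AE \<omega> in P (Some x). first_increase A \<omega> \<noteq> 0)"

end

text \<open>
  The function \<open>u\<close> is the (finite) density of the potential \<open>\<integral>\<^sub>0\<^sup>\<infinity> P\<^sup>x(Y\<^sub>t \<in> B) dt\<close> with respect to a
  reference measure \<open>m\<close>, and the local times \<open>L y\<close> are normalized by \<open>u(x,y) = E\<^sup>x(L\<^sup>y\<^sub>\<infinity>)\<close>. The local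
  times determine \<open>u(x,y)\<close> also at points \<open>y\<close> that are not charged by \<open>m\<close>.
\<close>

locale transient_process_with_local_times = right_process G F S Y \<theta> P
  for G :: "'w measure" and F :: "real \<Rightarrow> 'w measure" and S :: "'a topology"
    and Y :: "real \<Rightarrow> 'w \<Rightarrow> 'a option" and \<theta> :: "real \<Rightarrow> 'w \<Rightarrow> 'w"
    and P :: "'a option \<Rightarrow> 'w measure" +
  fixes m :: "'a measure"
    and L :: "'a \<Rightarrow> real \<Rightarrow> 'w \<Rightarrow> real"
    and u :: "'a \<Rightarrow> 'a \<Rightarrow> real"
  assumes sets_m: "sets m = Pow (topspace S)"
    and sigma_finite_m: "sigma_finite_measure m"
    and u_nonneg: "\<And>x y. \<lbrakk>x \<in> topspace S; y \<in> topspace S\<rbrakk> \<Longrightarrow> 0 \<le> u x y"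
    and potential_density: "\<And>x B. \<lbrakk>x \<in> topspace S; B \<subseteq> topspace S\<rbrakk> \<Longrightarrow>
      (\<integral>\<^sup>+t\<in>{0..}. emeasure (P (Some x)) {\<omega>\<in>space G. Y t \<omega> \<in> Some ` B} \<partial>lborel)
        = (\<integral>\<^sup>+y\<in>B. ennreal (u x y) \<partial>m)"
    and local_times: "\<And>y. y \<in> topspace S \<Longrightarrow> local_time y (L y)"
    and local_times_normalized: "\<And>x y. \<lbrakk>x \<in> topspace S; y \<in> topspace S\<rbrakk> \<Longrightarrow>
      (\<integral>\<^sup>+\<omega>. (SUP t\<in>{0..}. ennreal (L y t \<omega>)) \<partial>P (Some x)) = ennreal (u x y)"

section \<open>Permanental processes\<close>

definition kernel_matrix :: "('a \<Rightarrow> 'a \<Rightarrow> real) \<Rightarrow> 'a list \<Rightarrow> real Matrix.mat" where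
  "kernel_matrix u ts = Matrix.mat (length ts) (length ts) (\<lambda>(i, j). u (ts ! i) (ts ! j))"

definition permanental_process ::
  "'b measure \<Rightarrow> 'a set \<Rightarrow> real \<Rightarrow> ('a \<Rightarrow> 'a \<Rightarrow> real) \<Rightarrow> ('a \<Rightarrow> 'b \<Rightarrow> real) \<Rightarrow> bool" where
  "permanental_process M T \<alpha> u X \<longleftrightarrow>
     0 < \<alpha> \<and> prob_space M \<and>
     (\<forall>t\<in>T. X t \<in> borel_measurable M \<and> (\<forall>\<omega>\<in>space M. 0 \<le> X t \<omega>)) \<and>
     (\<forall>ts (s :: nat \<Rightarrow> real). set ts \<subseteq> T \<and> (\<forall>i<length ts. 0 \<le> s i) \<longrightarrow>
        (LINT \<omega>|M. exp (- (\<Sum>i<length ts. s i * X (ts ! i) \<omega>)))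
          = Determinant.det (1\<^sub>m (length ts) + kernel_matrix u ts * mat_diag (length ts) s) powr (- \<alpha>))"

text \<open>
  The \<open>k\<close>-th smallest diagonal element (\<open>k = 1, \<dots>, length ts\<close>) of the inverse of the kernel matrix.
\<close>

definition a_star :: "('a \<Rightarrow> 'a \<Rightarrow> real) \<Rightarrow> 'a list \<Rightarrow> nat \<Rightarrow> real" where
  "a_star u ts k = sort (diag_mat (the (mat_inverse (kernel_matrix u ts)))) ! (k - 1)"

text \<open>
  The diagonal elements are positive for the kernels considered here, so nothing is lost by passing to
  \<open>ennreal\<close>, where \<open>inf \<emptyset> = \<infinity>\<close>, \<open>\<lambda> / \<infinity> = 0\<close> and \<open>\<lambda> / 0 = \<infinity>\<close> for \<open>\<lambda> > 0\<close>.
\<close>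

definition psi_star :: "'a set \<Rightarrow> ('a \<Rightarrow> 'a \<Rightarrow> real) \<Rightarrow> nat \<Rightarrow> nat \<Rightarrow> ennreal" where
  "psi_star T u n k =
     (INF ts\<in>{ts. length ts = n \<and> distinct ts \<and> set ts \<subseteq> T}. ennreal (a_star u ts k))"

definition gamma_density :: "real \<Rightarrow> real \<Rightarrow> real" where
  "gamma_density \<alpha> x = (if 0 < x then x powr (\<alpha> - 1) * exp (- x) / Gamma \<alpha> else 0)"

end

theory Submission
  imports Defs
begin

text \<open>
  Let \<open>K\<close> be the kernel matrix of \<open>t\<^sub>1, \<dots>, t\<^sub>n\<close>. The strong Markov property at the first visit to
  \<open>{t\<^sub>j. j \<noteq> i}\<close>, for the process started at \<open>t\<^sub>i\<close>, gives \<open>(I - h) K = diag d\<close>, where \<open>h\<close> contains hitting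
  probabilities and \<open>d\<^sub>i > 0\<close> is the expected local time at \<open>t\<^sub>i\<close> before that visit. So the diagonal of
  the inverse of \<open>K\<close> is \<open>1 / d\<^sub>i\<close>, and the Laplace transform of \<open>(X\<^sub>t\<^sub>i / d\<^sub>i)\<close> is a constant times
  \<open>det (I - diag z h) powr (- \<alpha>) * (\<Prod>i. z\<^sub>i powr \<alpha>)\<close> with \<open>z\<^sub>i = 1 / (1 + s\<^sub>i)\<close>. Eliminating one variable at a time
  by Schur complements shows that \<open>det (I - diag z h) powr (- \<alpha>)\<close> is a power series in \<open>z\<close> with nonnegative
  coefficients. Hence \<open>(X\<^sub>t\<^sub>i / d\<^sub>i)\<close> is a mixture of vectors of independent gamma variables of shapes
  \<open>\<alpha> + k\<^sub>i\<close> with \<open>k\<^sub>i \<in> \<nat>\<close>, which are stochastically larger than gamma variables of shape \<open>\<alpha>\<close>. It remains to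
  restrict to the indices with the smallest values of \<open>1 / d\<^sub>i\<close> and to take the infimum over the tuples.
\<close>

section \<open>Hitting times and the inverse of the kernel matrix\<close>

context right_process
begin

text \<open>A visit to a finite set is detected through local times instead of the path of
  \<open>Y\<close>. The paths are merely right-continuous, in a topology that need not be discrete,
  so the times spent at a point are hard to control. A local time is continuous and nondecreasing,
  and the infimum of the rational times at which it is positive is an optional time for
  \<open>F\<close> as given. That the process then sits in the set follows from the defining
  property of a local time: it grows at once from its own point and from no other. The gamma shapes
  arise because \<open>z powr (\<alpha> + k)\<close> with \<open>z = 1 / (1 + s)\<close> is the
  Laplace transform of a gamma variable of shape \<open>\<alpha> + k\<close>. The normalizing
  constant is \<open>det (I - h) powr \<alpha>\<close>, which gives total mass 1 at
  \<open>z = 1\<close>, that is at \<open>s = 0\<close>. As \<alpha> is an arbitrary positive real,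
  nonnegativity of the coefficients is proved directly for real exponents. Laplace transforms are
  compared only at natural arguments, where they are moments of \<open>exp (- X)\<close>.\<close>

abbreviation states where "states \<equiv> insert None (Some ` topspace S)"

definition regular_path :: "(real \<Rightarrow> 'w \<Rightarrow> real) \<Rightarrow> 'w \<Rightarrow> bool" where
  "regular_path A \<omega> \<longleftrightarrow> A 0 \<omega> = 0 \<and> mono_on {0..} (\<lambda>t. A t \<omega>) \<and> continuous_on {0..} (\<lambda>t. A t \<omega>) \<and>
     (\<forall>s\<ge>0. \<forall>t\<ge>0. A (t + s) \<omega> = A t \<omega> + A s (\<theta> t \<omega>))"

text \<open>Unlike \<open>first_increase\<close>, this is measurable, because only rational times enter.\<close>

definition increase_time :: "(real \<Rightarrow> 'w \<Rightarrow> real) \<Rightarrow> 'w \<Rightarrow> ennreal" where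
  "increase_time A \<omega> = (INF q\<in>{q\<in>\<rat>. 0 \<le> q}. if 0 < A q \<omega> then ennreal q else \<top>)"

lemma measurable_F_imp_G:
  assumes "A \<in> borel_measurable (F t)"
  shows "A \<in> borel_measurable G"
  using measurable_mono[of borel borel "F t" G] assms sets_F[of t] space_F[of t] by auto

lemma countable_nonneg_rats: "countable {q\<in>\<rat>. 0 \<le> (q::real)}"
  by (rule countable_subset[OF _ countable_rat]) auto

lemma increase_time_less_iff:
  "increase_time A \<omega> < ennreal t \<longleftrightarrow> (\<exists>q\<in>\<rat>. 0 \<le> q \<and> q < t \<and> 0 < A q \<omega>)"
proof -
  have "increase_time A \<omega> < ennreal t \<longleftrightarrow>
    (\<exists>q\<in>{q\<in>\<rat>. 0 \<le> q}. (if 0 < A q \<omega> then ennreal q else \<top>) < ennreal t)"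
    unfolding increase_time_def by (rule INF_less_iff)
  also have "\<dots> \<longleftrightarrow> (\<exists>q\<in>\<rat>. 0 \<le> q \<and> q < t \<and> 0 < A q \<omega>)"
  proof -
    have "(if 0 < A q \<omega> then ennreal q else \<top>) < ennreal t \<longleftrightarrow> q < t \<and> 0 < A q \<omega>" if "0 \<le> q" for q
      using that by (simp add: ennreal_less_iff)
    then show ?thesis by blast
  qed
  finally show ?thesis .
qed

text \<open>Rational times are times, so this holds on every path. It carries
  \<open>first_increase A \<omega> \<noteq> 0\<close> over to \<open>increase_time\<close>; the
  converse transfer uses monotone paths.\<close>

lemma first_increase_le_increase_time: "first_increase A \<omega> \<le> increase_time A \<omega>"
  unfolding first_increase_def increase_time_def
  by (rule INF_greatest) (auto intro!: INF_lower)

lemma increase_time_measurable: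
  assumes "\<And>t. 0 \<le> t \<Longrightarrow> A t \<in> borel_measurable (F t)"
  shows "increase_time A \<in> borel_measurable G"
proof -
  have [measurable]: "A q \<in> borel_measurable G" if "q \<in> {q\<in>\<rat>. 0 \<le> q}" for q
    using assms[of q] that measurable_F_imp_G by auto
  show ?thesis
    unfolding increase_time_def
    by (rule borel_measurable_INF[OF countable_nonneg_rats]) measurable
qed

section \<open>Path properties of a continuous additive functional\<close>

lemma regular_path_after:
  assumes "regular_path A \<omega>" "0 \<le> t" "0 \<le> s"
  shows "A (t + s) \<omega> = A t \<omega> + A s (\<theta> t \<omega>)"
  using assms by (auto simp: regular_path_def)

lemma regular_path_mono:
  assumes "regular_path A \<omega>" "0 \<le> s" "s \<le> t"
  shows "A s \<omega> \<le> A t \<omega>"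
  using assms by (auto simp: regular_path_def mono_on_def)

text \<open>Left continuity at \<open>t\<close> and density of the rationals. This is what makes
  suprema and infima over rational times agree with values at real times.\<close>

lemma regular_path_left_approx:
  assumes "regular_path A \<omega>" "0 < t" "c < A t \<omega>"
  shows "\<exists>q\<in>\<rat>. 0 \<le> q \<and> q < t \<and> c < A q \<omega>"
proof -
  have "continuous (at t within {0..}) (\<lambda>t. A t \<omega>)"
    using assms by (auto simp: regular_path_def continuous_on_eq_continuous_within)
  then have "((\<lambda>t. A t \<omega>) \<longlongrightarrow> A t \<omega>) (at t within {0..})"
    by (simp add: continuous_within)
  then have "\<forall>\<^sub>F s in at t within {0..}. c < A s \<omega>"
    by (rule order_tendstoD) fact
  then obtain e where e: "0 < e" "\<And>s. s \<ge> 0 \<Longrightarrow> s \<noteq> t \<Longrightarrow> dist s t < e \<Longrightarrow> c < A s \<omega>"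
    unfolding eventually_at by auto
  obtain q where "q \<in> \<rat>" "max 0 (t - e) < q" "q < t"
    using Rats_dense_in_real[of "max 0 (t - e)" t] assms(2) e(1) by auto
  then show ?thesis
    using e(2)[of q] by (intro bexI[of _ q]) (auto simp: dist_real_def)
qed

lemma regular_path_at_increase_time:
  assumes "regular_path A \<omega>" "increase_time A \<omega> = ennreal t" "0 \<le> t"
  shows "A t \<omega> = 0"
proof -
  have "\<not> 0 < A t \<omega>"
  proof
    assume pos: "0 < A t \<omega>"
    then have "t \<noteq> 0" using assms(1) by (auto simp: regular_path_def)
    then have "0 < t" using assms(3) by simp
    from regular_path_left_approx[OF assms(1) this pos]
    have "increase_time A \<omega> < ennreal t" by (simp add: increase_time_less_iff)
    then show False using assms(2) by simp
  qed
  moreover have "A 0 \<omega> \<le> A t \<omega>" using regular_path_mono[OF assms(1)] assms(3) by auto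
  ultimately show ?thesis using assms(1) by (auto simp: regular_path_def)
qed

lemma regular_path_after_increase_time:
  assumes "regular_path A \<omega>" "increase_time A \<omega> = ennreal t" "0 \<le> t" "0 < s"
  shows "0 < A s (\<theta> t \<omega>)"
proof -
  have "increase_time A \<omega> < ennreal (t + s)" using assms by (simp add: ennreal_less_iff)
  then obtain q where q: "0 \<le> q" "q < t + s" "0 < A q \<omega>"
    by (auto simp: increase_time_less_iff)
  then have "0 < A (t + s) \<omega>" using regular_path_mono[OF assms(1), of q "t + s"] by auto
  then show ?thesis
    using regular_path_after[OF assms(1,3), of s] regular_path_at_increase_time[OF assms(1-3)] assms(4)
    by auto
qed

text \<open>The functional is still 0 at \<open>t\<close>, so by additivity its growth just after
  \<open>t\<close> is growth of the shifted functional near time 0. This is what later identifies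
  the position at a visit.\<close>

lemma increase_time_shift:
  assumes "regular_path A \<omega>" "increase_time A \<omega> = ennreal t" "0 \<le> t"
  shows "increase_time A (\<theta> t \<omega>) = 0"
proof (rule ccontr)
  assume "increase_time A (\<theta> t \<omega>) \<noteq> 0"
  then have "0 < increase_time A (\<theta> t \<omega>)" by (simp add: zero_less_iff_neq_zero)
  then obtain e where e: "0 < e" "ennreal e < increase_time A (\<theta> t \<omega>)"
    by (cases "increase_time A (\<theta> t \<omega>)")
      (use that[of 1] that[of "enn2real (increase_time A (\<theta> t \<omega>)) / 2"] in \<open>auto simp: ennreal_less_iff\<close>)
  obtain q where q: "q \<in> \<rat>" "0 < q" "q < e" using Rats_dense_in_real[OF e(1)] by auto
  have "0 < A q (\<theta> t \<omega>)"
    by (rule regular_path_after_increase_time[OF assms q(2)])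
  then have "increase_time A (\<theta> t \<omega>) < ennreal e"
    using q by (auto simp: increase_time_less_iff intro!: bexI[of _ q])
  then show False using e by auto
qed

lemma regular_path_increase_time_0:
  assumes "regular_path A \<omega>" "first_increase A \<omega> = 0" "0 < e"
  shows "\<exists>q\<in>\<rat>. 0 \<le> q \<and> q < e \<and> 0 < A q \<omega>"
proof -
  have "first_increase A \<omega> < ennreal e" using assms by simp
  then obtain t where t: "0 \<le> t" "0 < A t \<omega>" "t < e"
    unfolding first_increase_def by (auto simp: INF_less_iff ennreal_less_iff)
  obtain q where "q \<in> \<rat>" "t < q" "q < e" using Rats_dense_in_real[OF t(3)] by auto
  then show ?thesis using t regular_path_mono[OF assms(1), of t q] by (intro bexI[of _ q]) auto
qed

lemma regular_path_AE:
  assumes "continuous_additive_functional A" "z \<in> states"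
  shows "AE \<omega> in P z. regular_path A \<omega>"
proof -
  have "AE \<omega> in P z. A 0 \<omega> = 0 \<and> mono_on {0..} (\<lambda>t. A t \<omega>) \<and> continuous_on {0..} (\<lambda>t. A t \<omega>) \<and>
        (\<forall>s\<ge>0. \<forall>t\<ge>0. A (t + s) \<omega> = A t \<omega> + A s (\<theta> t \<omega>)) \<and>
        (\<forall>s\<ge>0. \<forall>t\<ge>s. Y s \<omega> = None \<longrightarrow> A t \<omega> = A s \<omega>)"
    using assms unfolding continuous_additive_functional_def by blast
  then show ?thesis by eventually_elim (auto simp: regular_path_def)
qed

text \<open>The functional is constant from the lifetime on, and here the lifetime is 0.\<close>

lemma cemetery_AE:
  assumes "continuous_additive_functional A"
  shows "AE \<omega> in P None. \<forall>t\<ge>0. A t \<omega> = 0"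
proof -
  have "AE \<omega> in P None. A 0 \<omega> = 0 \<and> mono_on {0..} (\<lambda>t. A t \<omega>) \<and> continuous_on {0..} (\<lambda>t. A t \<omega>) \<and>
        (\<forall>s\<ge>0. \<forall>t\<ge>0. A (t + s) \<omega> = A t \<omega> + A s (\<theta> t \<omega>)) \<and>
        (\<forall>s\<ge>0. \<forall>t\<ge>s. Y s \<omega> = None \<longrightarrow> A t \<omega> = A s \<omega>)"
    using bspec[OF conjunct2[OF assms[unfolded continuous_additive_functional_def]], of None] by simp
  moreover have "AE \<omega> in P None. Y 0 \<omega> = None" using normal[of None] by simp
  ultimately show ?thesis by eventually_elim (metis order_refl)
qed

end

section \<open>First visits to a finite set\<close>

context transient_process_with_local_times
begin

text \<open>The first visit to \<open>B\<close>, encoded by the growth of local times. That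
  \<open>Y\<close> is almost surely in \<open>B\<close> at this time, if it is finite, is
  \<open>Y_hit_AE\<close>.\<close>

definition hit :: "'a set \<Rightarrow> 'w \<Rightarrow> ennreal" where
  "hit B \<omega> = (INF b\<in>B. increase_time (L b) \<omega>)"

lemma L_caf: "y \<in> topspace S \<Longrightarrow> continuous_additive_functional (L y)"
  using local_times unfolding local_time_def by auto

lemma L_adapted: "y \<in> topspace S \<Longrightarrow> 0 \<le> t \<Longrightarrow> L y t \<in> borel_measurable (F t)"
  using L_caf unfolding continuous_additive_functional_def by auto

lemma L_measurable: "y \<in> topspace S \<Longrightarrow> 0 \<le> t \<Longrightarrow> L y t \<in> borel_measurable G"
  by (rule measurable_F_imp_G[OF L_adapted])

lemma hit_measurable:
  assumes "finite B" "B \<subseteq> topspace S"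
  shows "hit B \<in> borel_measurable G"
  unfolding hit_def using assms
  by (intro borel_measurable_INF countable_finite increase_time_measurable L_adapted) auto

lemma hit_less_iff:
  "hit B \<omega> < ennreal t \<longleftrightarrow> (\<exists>b\<in>B. \<exists>q\<in>\<rat>. 0 \<le> q \<and> q < t \<and> 0 < L b q \<omega>)"
  unfolding hit_def by (simp add: INF_less_iff increase_time_less_iff)

lemma hit_attained:
  assumes "finite B" "hit B \<omega> \<noteq> \<top>"
  shows "\<exists>b\<in>B. hit B \<omega> = increase_time (L b) \<omega>"
proof -
  have "B \<noteq> {}" using assms(2) by (auto simp: hit_def)
  let ?I = "(\<lambda>b. increase_time (L b) \<omega>) ` B"
  have "Min ?I \<in> ?I" using assms(1) \<open>B \<noteq> {}\<close> by (intro Min_in) auto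
  moreover have "Min ?I = Inf ?I" using assms(1) \<open>B \<noteq> {}\<close> by (intro Min_Inf) auto
  ultimately show ?thesis unfolding hit_def by auto
qed

text \<open>The event \<open>hit B < t\<close> is a countable union of events observed at rational
  times before \<open>t\<close>. The strict inequality matters: growth immediately after
  \<open>t\<close> is not visible in \<open>F t\<close>.\<close>

lemma hit_optional:
  assumes "finite B" "B \<subseteq> topspace S"
  shows "optional_time (space G) F (hit B)"
  unfolding optional_time_def
proof (intro allI impI)
  fix t :: real assume t: "0 \<le> t"
  have "{\<omega>\<in>space G. hit B \<omega> < ennreal t} =
    (\<Union>b\<in>B. \<Union>q\<in>{q\<in>\<rat>. 0 \<le> q \<and> q < t}. {\<omega>\<in>space (F q). 0 < L b q \<omega>})"
    by (auto simp: hit_less_iff space_F)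
  also have "\<dots> \<in> sets (F t)"
  proof (rule sets.finite_UN[OF assms(1)], rule sets.countable_UN'')
    show "countable {q\<in>\<rat>. 0 \<le> q \<and> q < t}"
      by (rule countable_subset[OF _ countable_rat]) auto
  next
    fix b q assume "b \<in> B" "q \<in> {q\<in>\<rat>. 0 \<le> q \<and> q < t}"
    then have "{\<omega>\<in>space (F q). 0 < L b q \<omega>} \<in> sets (F q)" "q \<le> t"
      using L_adapted[of b q] assms(2) by (auto intro!: borel_measurable_less)
    then show "{\<omega>\<in>space (F q). 0 < L b q \<omega>} \<in> sets (F t)"
      using sets_F_mono by auto
  qed
  finally show "{\<omega>\<in>space G. hit B \<omega> < ennreal t} \<in> sets (F t)" .
qed

lemma hit_shift:
  assumes "finite B" "\<And>b. b \<in> B \<Longrightarrow> regular_path (L b) \<omega>" "hit B \<omega> < \<top>"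
  shows "hit B (\<theta> (enn2real (hit B \<omega>)) \<omega>) = 0"
proof -
  obtain b where b: "b \<in> B" "hit B \<omega> = increase_time (L b) \<omega>"
    using hit_attained[OF assms(1), of \<omega>] assms(3) unfolding top.not_eq_extremum by blast
  have "increase_time (L b) (\<theta> (enn2real (hit B \<omega>)) \<omega>) = 0"
    using b assms(2,3) by (intro increase_time_shift) auto
  then have "hit B (\<theta> (enn2real (hit B \<omega>)) \<omega>) \<le> 0"
    using b unfolding hit_def by (metis INF_lower)
  then show ?thesis by simp
qed

text \<open>From a state outside \<open>B\<close> no \<open>L b\<close> grows immediately, by the
  last clause of \<open>local_time\<close>; from the cemetery all of them vanish. As
  \<open>B\<close> is finite, the infimum is attained and cannot be 0 either.\<close>

lemma hit_nonzero_AE: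
  assumes "finite B" "B \<subseteq> topspace S" "z \<in> states" "z \<notin> Some ` B"
  shows "AE \<omega> in P z. hit B \<omega> \<noteq> 0"
proof -
  have "AE \<omega> in P z. \<forall>b\<in>B. increase_time (L b) \<omega> \<noteq> 0"
  proof (rule AE_finite_allI[OF assms(1)])
    fix b assume b: "b \<in> B"
    show "AE \<omega> in P z. increase_time (L b) \<omega> \<noteq> 0"
    proof (cases z)
      case None
      have *: "increase_time (L b) \<omega> \<noteq> 0" if "\<forall>t\<ge>0. L b t \<omega> = 0" for \<omega>
      proof -
        have "\<not> increase_time (L b) \<omega> < ennreal 1" using that unfolding increase_time_less_iff by auto
        then show ?thesis by auto
      qed
      have "AE \<omega> in P None. \<forall>t\<ge>0. L b t \<omega> = 0" using b assms(2) by (intro cemetery_AE L_caf) auto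
      then show ?thesis unfolding None by (rule eventually_mono) (rule *)
    next
      case (Some x)
      then have "x \<in> topspace S - {b}" "b \<in> topspace S" using assms b by auto
      then have "AE \<omega> in P (Some x). first_increase (L b) \<omega> \<noteq> 0"
        using local_times[of b] unfolding local_time_def by auto
      then show ?thesis
        unfolding Some
        by eventually_elim (metis first_increase_le_increase_time le_zero_eq)
    qed
  qed
  then show ?thesis
  proof (rule AE_mp, intro AE_I2 impI notI)
    fix \<omega> assume *: "\<forall>b\<in>B. increase_time (L b) \<omega> \<noteq> 0" and 0: "hit B \<omega> = 0"
    then show False using hit_attained[OF assms(1), of \<omega>] by auto
  qed
qed

text \<open>The position at time \<tau> is \<open>Y 0\<close> of the shifted path, so measurability
  of the shift suffices.\<close>

lemma Y_at_optional_measurable: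
  assumes "optional_time (space G) F \<tau>" "W \<subseteq> states" "\<tau> \<in> borel_measurable G"
  shows "{\<omega>\<in>space G. \<tau> \<omega> < \<top> \<and> Y (enn2real (\<tau> \<omega>)) \<omega> \<in> W} \<in> sets G"
proof -
  let ?R = "restrict_space G {\<omega>. \<tau> \<omega> < \<infinity>}"
  have "Y 0 \<in> measurable (F 0) (count_space states)"
    by (rule adapted) simp
  then have Y0: "Y 0 \<in> measurable G (count_space states)"
    using measurable_mono[of "count_space states" "count_space states" "F 0" G] sets_F[of 0] space_F[of 0]
    by auto
  have *: "(\<lambda>\<omega>. Y 0 (\<theta> (enn2real (\<tau> \<omega>)) \<omega>)) \<in> measurable ?R (count_space states)"
    by (rule measurable_compose[OF shift_measurable[OF assms(1)] Y0])
  have set: "{\<omega>\<in>space G. \<tau> \<omega> < \<top>} \<in> sets G"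
    using assms(3) by measurable
  have sp: "space ?R = {\<omega>\<in>space G. \<tau> \<omega> < \<top>}"
    by (auto simp: space_restrict_space)
  have "(\<lambda>\<omega>. Y 0 (\<theta> (enn2real (\<tau> \<omega>)) \<omega>)) -` W \<inter> space ?R \<in> sets ?R"
    by (rule measurable_sets[OF *]) (use assms(2) in auto)
  also have "(\<lambda>\<omega>. Y 0 (\<theta> (enn2real (\<tau> \<omega>)) \<omega>)) -` W \<inter> space ?R =
      {\<omega>\<in>space G. \<tau> \<omega> < \<top> \<and> Y (enn2real (\<tau> \<omega>)) \<omega> \<in> W}"
    unfolding sp by (auto simp: shift)
  finally show ?thesis
    using set by (subst (asm) sets_restrict_space_iff) (auto simp: Int_def conj_commute)
qed

lemma Y_in_states:
  assumes "\<omega> \<in> space G" "0 \<le> t"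
  shows "Y t \<omega> \<in> states"
  using measurable_space[OF adapted[OF assms(2)], of \<omega>] assms(1) space_F[of t] by simp

lemma space_P: "z \<in> states \<Longrightarrow> space (P z) = space G"
  by (rule sets_eq_imp_space_eq[OF sets_P])

lemma strong_Markov_hit:
  assumes "finite B" "B \<subseteq> topspace S" "z \<in> states" "H \<in> borel_measurable G"
  shows "(\<integral>\<^sup>+\<omega>\<in>{\<omega>\<in>space G. hit B \<omega> < \<infinity>}. H (\<theta> (enn2real (hit B \<omega>)) \<omega>) \<partial>P z)
          = (\<integral>\<^sup>+\<omega>\<in>{\<omega>\<in>space G. hit B \<omega> < \<infinity>}. (\<integral>\<^sup>+\<omega>'. H \<omega>' \<partial>P (Y (enn2real (hit B \<omega>)) \<omega>)) \<partial>P z)"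
  using hit_optional[OF assms(1,2)]
  by (intro strong_Markov assms) (auto simp: optional_time_def)

text \<open>Apply the strong Markov property to the event \<open>hit B = 0\<close>. It holds almost
  surely for the path shifted to the visit, while a start outside \<open>B\<close> gives it
  probability 0. Hence a visit is at most as likely as a visit with position in
  \<open>B\<close>.\<close>

lemma Y_hit_AE:
  assumes B: "finite B" "B \<subseteq> topspace S" and z: "z \<in> states"
  shows "AE \<omega> in P z. hit B \<omega> < \<top> \<longrightarrow> Y (enn2real (hit B \<omega>)) \<omega> \<in> Some ` B"
proof -
  let ?D = "{\<omega>\<in>space G. hit B \<omega> < \<infinity>}"
  let ?W = "{\<omega>\<in>space G. hit B \<omega> < \<top> \<and> Y (enn2real (hit B \<omega>)) \<omega> \<in> Some ` B}"
  let ?H = "indicator {\<omega>\<in>space G. hit B \<omega> = 0} :: 'w \<Rightarrow> ennreal"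
  interpret Pz: prob_space "P z" by (rule prob_space_P[OF z])
  note [measurable] = hit_measurable[OF B]
  have D: "?D \<in> sets G" by measurable
  have W: "?W \<in> sets G"
    by (rule Y_at_optional_measurable[OF hit_optional[OF B]]) (use B in auto)
  have H: "?H \<in> borel_measurable G" by measurable
  have "AE \<omega> in P z. \<forall>b\<in>B. regular_path (L b) \<omega>"
    using B z by (intro AE_finite_allI regular_path_AE L_caf) auto
  then have *: "AE \<omega> in P z. hit B \<omega> < \<top> \<longrightarrow> hit B (\<theta> (enn2real (hit B \<omega>)) \<omega>) = 0"
    by eventually_elim (auto intro: hit_shift[OF B(1)])
  have "emeasure (P z) ?D = (\<integral>\<^sup>+\<omega>. indicator ?D \<omega> \<partial>P z)"
    using D sets_P[OF z] by simp
  also have "\<dots> = (\<integral>\<^sup>+\<omega>\<in>?D. ?H (\<theta> (enn2real (hit B \<omega>)) \<omega>) \<partial>P z)"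
    using * AE_space[of "P z"]
    by (intro nn_integral_cong_AE, eventually_elim)
       (auto simp: indicator_def space_P[OF z] intro!: shift_space)
  also have "\<dots> = (\<integral>\<^sup>+\<omega>\<in>?D. (\<integral>\<^sup>+\<omega>'. ?H \<omega>' \<partial>P (Y (enn2real (hit B \<omega>)) \<omega>)) \<partial>P z)"
    by (rule strong_Markov_hit[OF B z H])
  also have "\<dots> \<le> (\<integral>\<^sup>+\<omega>. indicator ?W \<omega> \<partial>P z)"
  proof (rule nn_integral_mono)
    fix \<omega> assume "\<omega> \<in> space (P z)"
    then have w: "\<omega> \<in> space G" using space_P[OF z] by simp
    let ?z = "Y (enn2real (hit B \<omega>)) \<omega>"
    have z': "?z \<in> states" by (rule Y_in_states[OF w]) simp
    interpret Pz': prob_space "P ?z" by (rule prob_space_P[OF z'])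
    have int: "(\<integral>\<^sup>+\<omega>'. ?H \<omega>' \<partial>P ?z) = emeasure (P ?z) {\<omega>\<in>space G. hit B \<omega> = 0}"
      using sets_P[OF z'] by (intro nn_integral_indicator) (simp, measurable)
    show "(\<integral>\<^sup>+\<omega>'. ?H \<omega>' \<partial>P ?z) * indicator ?D \<omega> \<le> indicator ?W \<omega>"
    proof (cases "?z \<in> Some ` B")
      case True
      then show ?thesis
        unfolding int using w Pz'.measure_le_1 by (auto simp: indicator_def Pz'.emeasure_le_1)
    next
      case False
      have "AE \<omega> in P ?z. hit B \<omega> \<noteq> 0" by (rule hit_nonzero_AE[OF B z' False])
      then have "emeasure (P ?z) {\<omega>\<in>space G. hit B \<omega> = 0} = 0"
        using sets_P[OF z'] space_P[OF z']
        by (subst (asm) AE_iff_measurable[of "{\<omega>\<in>space G. hit B \<omega> = 0}"]) auto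
      then show ?thesis unfolding int by simp
    qed
  qed
  also have "\<dots> = emeasure (P z) ?W" using W sets_P[OF z] by simp
  finally have le: "emeasure (P z) ?D \<le> emeasure (P z) ?W" .
  have "emeasure (P z) (?D - ?W) = emeasure (P z) ?D - emeasure (P z) ?W"
    using D W sets_P[OF z] by (intro emeasure_Diff) auto
  also have "\<dots> = 0" using le by (simp add: diff_eq_0_iff_ennreal Pz.emeasure_eq_measure)
  finally have "emeasure (P z) (?D - ?W) = 0" .
  then have "AE \<omega> in P z. \<omega> \<notin> ?D - ?W"
    using D W sets_P[OF z] by (intro AE_not_in) (auto simp: null_sets_def)
  with AE_space[of "P z"] show ?thesis
    by eventually_elim (auto simp: space_P[OF z])
qed

section \<open>Local time before and after a visit\<close>

definition total_local_time :: "'a \<Rightarrow> 'w \<Rightarrow> ennreal" where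
  "total_local_time y \<omega> = (SUP q\<in>{q\<in>\<rat>. 0 \<le> q}. ennreal (L y q \<omega>))"

text \<open>On regular paths this is \<open>L y\<close> evaluated at \<tau>, or the total local time
  where \<tau> is infinite. The supremum over rationals avoids a random time argument in the
  measurability proof.\<close>

definition local_time_before :: "('w \<Rightarrow> ennreal) \<Rightarrow> 'a \<Rightarrow> 'w \<Rightarrow> ennreal" where
  "local_time_before \<tau> y \<omega> =
     (SUP q\<in>{q\<in>\<rat>. 0 \<le> q}. if ennreal q < \<tau> \<omega> then ennreal (L y q \<omega>) else 0)"

lemma total_local_time_measurable:
  assumes "y \<in> topspace S"
  shows "total_local_time y \<in> borel_measurable G"
proof -
  have [measurable]: "L y q \<in> borel_measurable G" if "q \<in> {q\<in>\<rat>. 0 \<le> q}" for q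
    using that L_measurable[OF assms] by auto
  show ?thesis
    unfolding total_local_time_def by (rule borel_measurable_SUP[OF countable_nonneg_rats]) measurable
qed

lemma local_time_before_measurable:
  assumes "y \<in> topspace S" and [measurable]: "\<tau> \<in> borel_measurable G"
  shows "local_time_before \<tau> y \<in> borel_measurable G"
proof -
  have [measurable]: "L y q \<in> borel_measurable G" if "q \<in> {q\<in>\<rat>. 0 \<le> q}" for q
    using that L_measurable[OF assms(1)] by auto
  show ?thesis
    unfolding local_time_before_def by (rule borel_measurable_SUP[OF countable_nonneg_rats]) measurable
qed

lemma nonneg_rat_above: "\<exists>q\<in>{q\<in>\<rat>. 0 \<le> q}. (t::real) \<le> q"
  by (rule bexI[of _ "of_nat (nat \<lceil>t\<rceil>)"]) (auto simp: of_nat_ceiling)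

lemma total_local_time_eq_SUP:
  assumes "regular_path (L y) \<omega>"
  shows "total_local_time y \<omega> = (SUP t\<in>{0..}. ennreal (L y t \<omega>))"
proof (rule antisym)
  show "total_local_time y \<omega> \<le> (SUP t\<in>{0..}. ennreal (L y t \<omega>))"
    unfolding total_local_time_def by (rule SUP_subset_mono) auto
  show "(SUP t\<in>{0..}. ennreal (L y t \<omega>)) \<le> total_local_time y \<omega>"
    unfolding total_local_time_def
  proof (rule SUP_mono)
    fix t :: real assume t: "t \<in> {0..}"
    obtain q where "q \<in> {q\<in>\<rat>. 0 \<le> q}" "t \<le> q" using nonneg_rat_above[of t] by blast
    then show "\<exists>q\<in>{q\<in>\<rat>. 0 \<le> q}. ennreal (L y t \<omega>) \<le> ennreal (L y q \<omega>)"
      using regular_path_mono[OF assms, of t q] t by (intro bexI[of _ q] ennreal_leI) auto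
  qed
qed

lemma nn_integral_total_local_time:
  assumes "x \<in> topspace S" "y \<in> topspace S"
  shows "(\<integral>\<^sup>+\<omega>. total_local_time y \<omega> \<partial>P (Some x)) = ennreal (u x y)"
proof -
  have "AE \<omega> in P (Some x). regular_path (L y) \<omega>"
    using assms by (intro regular_path_AE L_caf) auto
  then have "(\<integral>\<^sup>+\<omega>. total_local_time y \<omega> \<partial>P (Some x)) = (\<integral>\<^sup>+\<omega>. (SUP t\<in>{0..}. ennreal (L y t \<omega>)) \<partial>P (Some x))"
    by (intro nn_integral_cong_AE) (auto elim!: eventually_mono simp: total_local_time_eq_SUP)
  then show ?thesis using local_times_normalized[OF assms] by simp
qed

lemma local_time_before_finite:
  assumes reg: "regular_path (L y) \<omega>" and T: "\<tau> \<omega> = ennreal T" "0 \<le> T"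
  shows "local_time_before \<tau> y \<omega> = ennreal (L y T \<omega>)"
proof (rule antisym)
  show "local_time_before \<tau> y \<omega> \<le> ennreal (L y T \<omega>)"
    unfolding local_time_before_def
  proof (rule SUP_least)
    fix q :: real assume "q \<in> {q\<in>\<rat>. 0 \<le> q}"
    then show "(if ennreal q < \<tau> \<omega> then ennreal (L y q \<omega>) else 0) \<le> ennreal (L y T \<omega>)"
      using regular_path_mono[OF reg, of q T] T by (auto simp: ennreal_less_iff intro!: ennreal_leI)
  qed
  show "ennreal (L y T \<omega>) \<le> local_time_before \<tau> y \<omega>"
    unfolding local_time_before_def le_SUP_iff
  proof (intro allI impI)
    fix c assume c: "c < ennreal (L y T \<omega>)"
    then obtain r where r: "c = ennreal r" "0 \<le> r" by (cases c) auto
    then have less: "r < L y T \<omega>" using c by (simp add: ennreal_less_iff)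
    then have "T \<noteq> 0" using r(2) reg by (auto simp: regular_path_def)
    then have "0 < T" using T by simp
    from regular_path_left_approx[OF reg this less]
    obtain q where q: "q \<in> \<rat>" "0 \<le> q" "q < T" "r < L y q \<omega>" by auto
    then have "c < (if ennreal q < \<tau> \<omega> then ennreal (L y q \<omega>) else 0)"
      using r T by (simp add: ennreal_less_iff)
    then show "\<exists>q\<in>{q\<in>\<rat>. 0 \<le> q}. c < (if ennreal q < \<tau> \<omega> then ennreal (L y q \<omega>) else 0)"
      using q by (intro bexI[of _ q]) auto
  qed
qed

text \<open>Additivity gives \<open>L y (T + q) \<omega> = L y T \<omega> + L y q (\<theta> T
  \<omega>)\<close>. The times \<open>T + q\<close> need not be rational; by monotonicity they and
  the rational times yield the same supremum.\<close>

lemma total_local_time_split: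
  assumes reg: "regular_path (L y) \<omega>"
  shows "total_local_time y \<omega> =
    local_time_before \<tau> y \<omega> + (if \<tau> \<omega> < \<top> then total_local_time y (\<theta> (enn2real (\<tau> \<omega>)) \<omega>) else 0)"
proof (cases "\<tau> \<omega>")
  case top
  then show ?thesis by (simp add: total_local_time_def local_time_before_def)
next
  case (real T)
  have "local_time_before \<tau> y \<omega> + total_local_time y (\<theta> T \<omega>) =
      (SUP q\<in>{q\<in>\<rat>. 0 \<le> q}. ennreal (L y T \<omega>) + ennreal (L y q (\<theta> T \<omega>)))"
    unfolding local_time_before_finite[where \<tau>=\<tau>, OF reg real(2,1)] unfolding total_local_time_def
    by (rule ennreal_SUP_add_right) (use nonneg_rat_above[of 0] in auto)
  also have "\<dots> = (SUP q\<in>{q\<in>\<rat>. 0 \<le> q}. ennreal (L y (T + q) \<omega>))"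
  proof (rule SUP_cong[OF refl])
    fix q :: real assume q: "q \<in> {q\<in>\<rat>. 0 \<le> q}"
    have "0 \<le> L y T \<omega>" "L y T \<omega> \<le> L y (T + q) \<omega>"
      using regular_path_mono[OF reg, of 0 T] regular_path_mono[OF reg, of T "T + q"] reg real q
      by (auto simp: regular_path_def)
    moreover have "L y (T + q) \<omega> = L y T \<omega> + L y q (\<theta> T \<omega>)"
      using regular_path_after[OF reg, of T q] real q by simp
    ultimately show "ennreal (L y T \<omega>) + ennreal (L y q (\<theta> T \<omega>)) = ennreal (L y (T + q) \<omega>)"
      by simp
  qed
  also have "\<dots> = total_local_time y \<omega>"
    unfolding total_local_time_def
  proof (rule antisym; rule SUP_mono)
    fix q :: real assume q: "q \<in> {q\<in>\<rat>. 0 \<le> q}"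
    show "\<exists>q'\<in>{q\<in>\<rat>. 0 \<le> q}. ennreal (L y q \<omega>) \<le> ennreal (L y (T + q') \<omega>)"
      using q regular_path_mono[OF reg, of q "T + q"] real by (intro bexI[OF _ q] ennreal_leI) auto
    obtain q' where "q' \<in> {q\<in>\<rat>. 0 \<le> q}" "T + q \<le> q'" using nonneg_rat_above[of "T + q"] by blast
    then show "\<exists>q'\<in>{q\<in>\<rat>. 0 \<le> q}. ennreal (L y (T + q) \<omega>) \<le> ennreal (L y q' \<omega>)"
      using q regular_path_mono[OF reg, of "T + q" q'] real by (intro bexI[of _ q'] ennreal_leI) auto
  qed
  finally show ?thesis using real by simp
qed

lemma local_time_before_hit_zero:
  assumes "y \<in> B"
  shows "local_time_before (hit B) y \<omega> = 0"
proof -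
  have "(if ennreal q < hit B \<omega> then ennreal (L y q \<omega>) else 0) \<le> 0" if q: "q \<in> {q\<in>\<rat>. 0 \<le> q}" for q
  proof (cases "ennreal q < hit B \<omega>")
    case True
    \<comment> \<open>A bound strictly above \<open>q\<close> is required, since
      \<open>hit_less_iff\<close> sees growth only at rational times before its bound;
      \<open>hit B \<omega>\<close> itself may be infinite.\<close>
    obtain t where t: "q < t" "ennreal t \<le> hit B \<omega>"
    proof (cases "hit B \<omega>")
      case top
      then show ?thesis using that[of "q + 1"] by simp
    next
      case (real r)
      then show ?thesis using that[of r] True q by (simp add: ennreal_less_iff)
    qed
    then have "\<not> hit B \<omega> < ennreal t" by simp
    then have "\<not> 0 < L y q \<omega>" unfolding hit_less_iff using assms q t(1) by blast
    then show ?thesis by (simp add: ennreal_neg)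
  qed simp
  then have "local_time_before (hit B) y \<omega> \<le> 0" unfolding local_time_before_def by (rule SUP_least)
  then show ?thesis by simp
qed

text \<open>Split the total local time at the first visit to \<open>B\<close>; the strong Markov property evaluates the
  part after the visit.\<close>

lemma potential_decomposition:
  assumes B: "finite B" "B \<subseteq> topspace S" and x: "x \<in> topspace S" and y: "y \<in> topspace S"
  shows "ennreal (u x y) = (\<integral>\<^sup>+\<omega>. local_time_before (hit B) y \<omega> \<partial>P (Some x)) +
    (\<Sum>b\<in>B. ennreal (u b y) * emeasure (P (Some x))
       {\<omega>\<in>space G. hit B \<omega> < \<top> \<and> Y (enn2real (hit B \<omega>)) \<omega> \<in> {Some b}})"
proof -
  let ?P = "P (Some x)"
  let ?D = "{\<omega>\<in>space G. hit B \<omega> < \<infinity>}"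
  let ?W = "\<lambda>b. {\<omega>\<in>space G. hit B \<omega> < \<top> \<and> Y (enn2real (hit B \<omega>)) \<omega> \<in> {Some b}}"
  have z: "Some x \<in> states" using x by simp
  note [measurable_cong] = sets_P[OF z]
  note hm[measurable] = hit_measurable[OF B]
  have D[measurable]: "?D \<in> sets G" by measurable
  have W: "?W b \<in> sets G" if "b \<in> B" for b
    by (rule Y_at_optional_measurable[OF hit_optional[OF B] _ hm]) (use B that in auto)
  note [measurable] = local_time_before_measurable[OF y hm] total_local_time_measurable[OF y]
  \<comment> \<open>The shift to the visit is measurable only where \<open>hit B\<close> is finite;
    the indicator extends the integrand by 0.\<close>
  have [measurable]: "(\<lambda>\<omega>. total_local_time y (\<theta> (enn2real (hit B \<omega>)) \<omega>) * indicator ?D \<omega>) \<in> borel_measurable G"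
  proof -
    have "(\<lambda>\<omega>. total_local_time y (\<theta> (enn2real (hit B \<omega>)) \<omega>)) \<in>
        borel_measurable (restrict_space G {\<omega>. hit B \<omega> < \<infinity>})"
      by (rule measurable_compose[OF shift_measurable[OF hit_optional[OF B]] total_local_time_measurable[OF y]])
    moreover have "{\<omega>. hit B \<omega> < \<infinity>} \<inter> space G = ?D" by auto
    ultimately have "(\<lambda>\<omega>. total_local_time y (\<theta> (enn2real (hit B \<omega>)) \<omega>) * indicator {\<omega>. hit B \<omega> < \<infinity>} \<omega>) \<in> borel_measurable G"
      using D by (subst (asm) borel_measurable_restrict_space_iff_ennreal) simp_all
    then show ?thesis
      by (rule measurable_cong[THEN iffD1, rotated]) (simp add: indicator_def)
  qed
  have reg: "AE \<omega> in ?P. regular_path (L y) \<omega>"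
    using y z by (intro regular_path_AE L_caf) auto
  have "ennreal (u x y) = (\<integral>\<^sup>+\<omega>. total_local_time y \<omega> \<partial>?P)"
    by (rule nn_integral_total_local_time[OF x y, symmetric])
  also have "\<dots> = (\<integral>\<^sup>+\<omega>. local_time_before (hit B) y \<omega> +
      total_local_time y (\<theta> (enn2real (hit B \<omega>)) \<omega>) * indicator ?D \<omega> \<partial>?P)"
  proof (rule nn_integral_cong_AE, goal_cases)
    case 1
    show ?case using reg AE_space[of ?P]
    proof eventually_elim
      case (elim \<omega>)
      then show ?case
        using total_local_time_split[OF elim(1), of "hit B"] by (auto simp: space_P[OF z])
    qed
  qed
  also have "\<dots> = (\<integral>\<^sup>+\<omega>. local_time_before (hit B) y \<omega> \<partial>?P) +
      (\<integral>\<^sup>+\<omega>\<in>?D. total_local_time y (\<theta> (enn2real (hit B \<omega>)) \<omega>) \<partial>?P)"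
    by (rule nn_integral_add) measurable
  also have "(\<integral>\<^sup>+\<omega>\<in>?D. total_local_time y (\<theta> (enn2real (hit B \<omega>)) \<omega>) \<partial>?P) =
      (\<integral>\<^sup>+\<omega>\<in>?D. (\<integral>\<^sup>+\<omega>'. total_local_time y \<omega>' \<partial>P (Y (enn2real (hit B \<omega>)) \<omega>)) \<partial>?P)"
    by (rule strong_Markov_hit[OF B z total_local_time_measurable[OF y]])
  \<comment> \<open>By \<open>Y_hit_AE\<close> the position at the visit is one of the finitely many
    points of \<open>B\<close>, and from \<open>b\<close> the expected total local time is
    \<open>u b y\<close>.\<close>
  also have "\<dots> = (\<integral>\<^sup>+\<omega>. (\<Sum>b\<in>B. ennreal (u b y) * indicator (?W b) \<omega>) \<partial>?P)"
  proof (rule nn_integral_cong_AE, goal_cases)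
    case 1
    show ?case using Y_hit_AE[OF B z] AE_space[of ?P]
    proof eventually_elim
      case (elim \<omega>)
      have w: "\<omega> \<in> space G" using elim(2) space_P[OF z] by simp
      show ?case
      proof (cases "hit B \<omega> < \<top>")
        case True
        with elim obtain b where b: "b \<in> B" "Y (enn2real (hit B \<omega>)) \<omega> = Some b" by auto
        have "(\<Sum>b'\<in>B. ennreal (u b' y) * indicator (?W b') \<omega>) =
            (\<Sum>b'\<in>B. if b' = b then ennreal (u b y) else 0)"
          using True w b by (intro sum.cong) (auto simp: indicator_def)
        also have "\<dots> = ennreal (u b y)" using b B by simp
        finally show ?thesis
          using True w b nn_integral_total_local_time[of b y] y B by (auto simp: subset_iff)
      qed (simp add: indicator_def)
    qed
  qed
  also have "\<dots> = (\<Sum>b\<in>B. ennreal (u b y) * emeasure ?P (?W b))"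
    using W sets_P[OF z] by (subst nn_integral_sum) (auto simp: nn_integral_cmult_indicator)
  finally show ?thesis .
qed

text \<open>Here \<open>h b\<close> is the probability that the first visit to \<open>B\<close> is
  at \<open>b\<close>, and \<open>d\<close> is the expected local time at \<open>x\<close> before
  it. At points of \<open>B\<close> no local time accrues before the visit, so only the entry at
  \<open>x\<close> itself has an extra term.\<close>

lemma kernel_row:
  assumes B: "finite B" "B \<subseteq> topspace S" and x: "x \<in> topspace S" "x \<notin> B"
  obtains d :: real and h :: "'a \<Rightarrow> real" where "0 < d" "\<And>b. 0 \<le> h b"
    "\<And>y. y \<in> B \<Longrightarrow> u x y = (\<Sum>b\<in>B. h b * u b y)" "u x x = d + (\<Sum>b\<in>B. h b * u b x)"
proof -
  let ?P = "P (Some x)"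
  let ?W = "\<lambda>b. {\<omega>\<in>space G. hit B \<omega> < \<top> \<and> Y (enn2real (hit B \<omega>)) \<omega> \<in> {Some b}}"
  have z: "Some x \<in> states" using x by simp
  interpret prob_space ?P by (rule prob_space_P[OF z])
  define h where "h b = measure ?P (?W b)" for b
  define D where "D = (\<integral>\<^sup>+\<omega>. local_time_before (hit B) x \<omega> \<partial>?P)"
  have eq: "(\<Sum>b\<in>B. ennreal (u b y) * emeasure ?P (?W b)) = ennreal (\<Sum>b\<in>B. h b * u b y)"
    if "y \<in> topspace S" for y
    using that B u_nonneg unfolding h_def emeasure_eq_measure
    by (subst sum_ennreal[symmetric]) (auto intro!: sum.cong simp: ennreal_mult' mult.commute)
  have nn: "0 \<le> (\<Sum>b\<in>B. h b * u b y)" if "y \<in> topspace S" for y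
    using that B u_nonneg by (intro sum_nonneg mult_nonneg_nonneg) (auto simp: h_def)
  have 1: "u x y = (\<Sum>b\<in>B. h b * u b y)" if "y \<in> B" for y
  proof -
    have y: "y \<in> topspace S" using that B by auto
    have "ennreal (u x y) = ennreal (\<Sum>b\<in>B. h b * u b y)"
      using potential_decomposition[OF B x(1) y] unfolding eq[OF y] local_time_before_hit_zero[OF that] by simp
    then show ?thesis using nn[OF y] u_nonneg[OF x(1) y] by simp
  qed
  have dec: "ennreal (u x x) = D + ennreal (\<Sum>b\<in>B. h b * u b x)"
    using potential_decomposition[OF B x(1) x(1)] unfolding eq[OF x(1)] D_def .
  \<comment> \<open>From \<open>x\<close>, which is outside \<open>B\<close>, the visit takes
    positive time while \<open>L x\<close> grows at once. So the local time at \<open>x\<close>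
    before the visit is almost surely positive.\<close>
  have "D \<noteq> 0"
  proof
    assume "D = 0"
    have "AE \<omega> in ?P. local_time_before (hit B) x \<omega> = 0"
      using \<open>D = 0\<close> local_time_before_measurable[OF x(1) hit_measurable[OF B]] sets_P[OF z]
      unfolding D_def by (subst (asm) nn_integral_0_iff_AE) (auto cong: measurable_cong_sets)
    moreover have "AE \<omega> in ?P. hit B \<omega> \<noteq> 0"
      by (rule hit_nonzero_AE[OF B z]) (use x in auto)
    moreover have "AE \<omega> in ?P. first_increase (L x) \<omega> = 0"
      using local_times[OF x(1)] unfolding local_time_def by auto
    moreover have "AE \<omega> in ?P. regular_path (L x) \<omega>"
      using x z by (intro regular_path_AE L_caf) auto
    ultimately have "AE \<omega> in ?P. False"
    proof eventually_elim
      case (elim \<omega>)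
      obtain e where e: "0 < e" "ennreal e \<le> hit B \<omega>"
      proof (cases "hit B \<omega>")
        case top
        then show ?thesis using that[of 1] by simp
      next
        case (real r)
        then show ?thesis using that[of r] elim(2) by (cases "r = 0") auto
      qed
      obtain q where q: "q \<in> \<rat>" "0 \<le> q" "q < e" "0 < L x q \<omega>"
        using regular_path_increase_time_0[OF elim(4,3) e(1)] by auto
      have "ennreal q < hit B \<omega>"
        using q e by (intro order_less_le_trans[OF _ e(2)]) (simp add: ennreal_less_iff)
      then have "ennreal (L x q \<omega>) \<le> local_time_before (hit B) x \<omega>"
        unfolding local_time_before_def using q by (intro SUP_upper2[of q]) auto
      then show False using elim(1) q by (simp add: ennreal_eq_0_iff)
    qed
    then show False by simp
  qed
  have "D \<noteq> \<top>" using dec by auto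
  then obtain d where d: "D = ennreal d" "0 < d" using \<open>D \<noteq> 0\<close> by (cases D) auto
  have "u x x = d + (\<Sum>b\<in>B. h b * u b x)"
    using dec d nn[OF x(1)] u_nonneg[OF x(1) x(1)] by (simp add: ennreal_plus[symmetric] del: ennreal_plus)
  then show ?thesis using that[of d h] d(2) 1 by (auto simp: h_def)
qed

end

section \<open>Power series with nonnegative coefficients\<close>

text \<open>Monomials are indexed by words instead of multi-indices, so that multiplying them amounts to
  concatenating the words.\<close>

definition word_series :: "(nat \<Rightarrow> real) set \<Rightarrow> ((nat \<Rightarrow> real) \<Rightarrow> real) \<Rightarrow> bool" where
  "word_series Z g \<longleftrightarrow> (\<forall>z\<in>Z. 0 \<le> g z) \<and> (\<exists>c. \<forall>z\<in>Z.
     ennreal (g z) = (\<integral>\<^sup>+w. c w * ennreal (prod_list (map z w)) \<partial>count_space UNIV))"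

lemma word_series_nonneg: "word_series Z g \<Longrightarrow> z \<in> Z \<Longrightarrow> 0 \<le> g z"
  by (auto simp: word_series_def)

lemma word_series_cong:
  assumes "word_series Z g" "\<And>z. z \<in> Z \<Longrightarrow> g z = g' z"
  shows "word_series Z g'"
  using assms by (auto simp: word_series_def)

text \<open>The coefficients are pushed forward along \<open>t\<close>: a word reached from several
  indices collects the sum of their coefficients, so \<open>t\<close> need not be injective. With
  values in \<open>ennreal\<close>, the interchange of sums raises no question of
  convergence.\<close>

lemma word_series_reindex:
  fixes t :: "'x \<Rightarrow> nat list" and c :: "'x \<Rightarrow> ennreal"
  assumes "\<And>z. z \<in> Z \<Longrightarrow> 0 \<le> g z"
    and "\<And>z. z \<in> Z \<Longrightarrow>
      ennreal (g z) = (\<integral>\<^sup>+x. c x * ennreal (prod_list (map z (t x))) \<partial>count_space UNIV)"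
  shows "word_series Z g"
  unfolding word_series_def
proof (intro conjI ballI exI)
  fix z assume z: "z \<in> Z"
  show "0 \<le> g z" by (rule assms(1)[OF z])
  let ?m = "\<lambda>w. ennreal (prod_list (map z w))"
  let ?F = "\<lambda>(w, x). c x * indicator {t x} w * ?m w"
  have "(\<integral>\<^sup>+w. (\<integral>\<^sup>+x. c x * indicator {t x} w \<partial>count_space UNIV) * ?m w \<partial>count_space UNIV) =
      (\<integral>\<^sup>+w. \<integral>\<^sup>+x. ?F (w, x) \<partial>count_space UNIV \<partial>count_space UNIV)"
    by (intro nn_integral_cong) (simp add: nn_integral_multc)
  also have "\<dots> = (\<integral>\<^sup>+x. \<integral>\<^sup>+w. ?F (w, x) \<partial>count_space UNIV \<partial>count_space UNIV)"
    unfolding nn_integral_fst_count_space nn_integral_snd_count_space ..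
  also have "\<dots> = (\<integral>\<^sup>+x. \<integral>\<^sup>+w. c x * ?m (t x) * indicator {t x} w \<partial>count_space UNIV \<partial>count_space UNIV)"
    by (intro nn_integral_cong) (auto simp: indicator_def)
  also have "\<dots> = (\<integral>\<^sup>+x. c x * ?m (t x) \<partial>count_space UNIV)"
    by (simp add: nn_integral_cmult_indicator)
  finally show "ennreal (g z) = (\<integral>\<^sup>+w. (\<integral>\<^sup>+x. c x * indicator {t x} w \<partial>count_space UNIV) * ?m w \<partial>count_space UNIV)"
    using assms(2)[OF z] by simp
qed

lemma word_series_const:
  assumes "0 \<le> a"
  shows "word_series Z (\<lambda>z. a)"
proof (rule word_series_reindex[where c="\<lambda>x::unit. ennreal a" and t="\<lambda>x. []"])
  show "ennreal a = (\<integral>\<^sup>+x. ennreal a * ennreal (prod_list (map z [])) \<partial>count_space (UNIV :: unit set))" for z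
    by (simp add: nn_integral_count_space_finite)
qed (use assms in auto)

lemma word_series_var:
  assumes "\<And>z. z \<in> Z \<Longrightarrow> 0 \<le> z i"
  shows "word_series Z (\<lambda>z. z i)"
proof (rule word_series_reindex[where c="\<lambda>x::unit. 1" and t="\<lambda>x. [i]"])
  show "ennreal (z i) = (\<integral>\<^sup>+x. 1 * ennreal (prod_list (map z [i])) \<partial>count_space (UNIV :: unit set))" for z
    by (simp add: nn_integral_count_space_finite)
qed (use assms in auto)

lemma word_series_mult:
  assumes Z: "\<forall>z\<in>Z. \<forall>i. 0 \<le> z i" and "word_series Z f" "word_series Z g"
  shows "word_series Z (\<lambda>z. f z * g z)"
proof -
  let ?m = "\<lambda>z w. ennreal (prod_list (map z w))"
  obtain c d where c: "\<And>z. z \<in> Z \<Longrightarrow> ennreal (f z) = (\<integral>\<^sup>+w. c w * ?m z w \<partial>count_space UNIV)"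
    and d: "\<And>z. z \<in> Z \<Longrightarrow> ennreal (g z) = (\<integral>\<^sup>+w. d w * ?m z w \<partial>count_space UNIV)"
    using assms(2,3) unfolding word_series_def by auto
  show ?thesis
  proof (rule word_series_reindex[where c="\<lambda>(v, w). c v * d w" and t="\<lambda>(v, w). v @ w"])
    fix z assume z: "z \<in> Z"
    show "0 \<le> f z * g z" using assms(2,3) z by (simp add: word_series_nonneg)
    have nn: "0 \<le> prod_list (map z w)" for w
      using Z z by (induction w) auto
    have "ennreal (f z * g z) = ennreal (f z) * ennreal (g z)"
      using assms(2,3) z by (simp add: word_series_nonneg ennreal_mult)
    also have "\<dots> = (\<integral>\<^sup>+v. (c v * ?m z v) * (\<integral>\<^sup>+w. d w * ?m z w \<partial>count_space UNIV) \<partial>count_space UNIV)"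
      unfolding c[OF z] d[OF z] by (simp add: nn_integral_multc)
    also have "\<dots> = (\<integral>\<^sup>+v. \<integral>\<^sup>+w. (c v * ?m z v) * (d w * ?m z w) \<partial>count_space UNIV \<partial>count_space UNIV)"
      by (simp add: nn_integral_cmult)
    also have "\<dots> = (\<integral>\<^sup>+v. \<integral>\<^sup>+w. (case (v, w) of (v, w) \<Rightarrow> c v * d w) *
        ?m z (case (v, w) of (v, w) \<Rightarrow> v @ w) \<partial>count_space UNIV \<partial>count_space UNIV)"
      by (intro nn_integral_cong) (simp only: prod.case map_append prod_list.append ennreal_mult[OF nn nn] mult_ac)
    also have "\<dots> = (\<integral>\<^sup>+x. (case x of (v, w) \<Rightarrow> c v * d w) * ?m z (case x of (v, w) \<Rightarrow> v @ w) \<partial>count_space UNIV)"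
      by (rule nn_integral_fst_count_space)
    finally show "ennreal (f z * g z) = \<dots>" .
  qed
qed

lemma word_series_sums:
  assumes "\<And>k::nat. word_series Z (f k)" "\<And>z. z \<in> Z \<Longrightarrow> (\<lambda>k. f k z) sums g z"
  shows "word_series Z g"
proof -
  let ?m = "\<lambda>z w. ennreal (prod_list (map z w))"
  have "\<forall>k. \<exists>c. \<forall>z\<in>Z. ennreal (f k z) = (\<integral>\<^sup>+w. c w * ?m z w \<partial>count_space UNIV)"
    using assms(1) unfolding word_series_def by blast
  then obtain c where c: "\<And>k z. z \<in> Z \<Longrightarrow> ennreal (f k z) = (\<integral>\<^sup>+w. c k w * ?m z w \<partial>count_space UNIV)"
    by metis
  show ?thesis
    unfolding word_series_def
  proof (intro conjI ballI exI)
    fix z assume z: "z \<in> Z"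
    have nn: "0 \<le> f k z" for k using assms(1) z by (rule word_series_nonneg)
    show "0 \<le> g z" using sums_le[OF _ sums_zero assms(2)[OF z]] nn by simp
    have "ennreal (g z) = (\<Sum>k. ennreal (f k z))"
      using assms(2)[OF z] nn by (metis suminf_ennreal2 sums_iff)
    also have "\<dots> = (\<Sum>k. \<integral>\<^sup>+w. c k w * ?m z w \<partial>count_space UNIV)" using c[OF z] by simp
    also have "\<dots> = (\<integral>\<^sup>+w. (\<Sum>k. c k w * ?m z w) \<partial>count_space UNIV)"
      by (rule nn_integral_suminf[symmetric]) simp
    also have "\<dots> = (\<integral>\<^sup>+w. (\<Sum>k. c k w) * ?m z w \<partial>count_space UNIV)" by simp
    finally show "ennreal (g z) = \<dots>" .
  qed
qed

lemma word_series_add: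
  assumes "word_series Z f" "word_series Z g"
  shows "word_series Z (\<lambda>z. f z + g z)"
proof (rule word_series_sums[where f="\<lambda>k. if k = 0 then f else if k = 1 then g else (\<lambda>z. 0)"])
  show "(\<lambda>k::nat. (if k = 0 then f else if k = 1 then g else (\<lambda>z. 0)) z) sums (f z + g z)" for z
    using sums_finite[of "{0, 1::nat}" "\<lambda>k. (if k = 0 then f else if k = 1 then g else (\<lambda>z. 0)) z"]
    by simp
qed (use assms word_series_const in auto)

lemma word_series_power:
  assumes "\<forall>z\<in>Z. \<forall>i. 0 \<le> z i" "word_series Z f"
  shows "word_series Z (\<lambda>z. f z ^ k)"
  by (induction k) (auto intro!: word_series_const word_series_mult[OF assms(1) assms(2)])

text \<open>The binomial series with exponent \<open>- a\<close> has the coefficients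
  \<open>pochhammer a k / fact k\<close>, which are nonnegative for
  \<open>a \<ge> 0\<close>.\<close>

lemma word_series_neg_powr:
  assumes Z: "\<forall>z\<in>Z. \<forall>i. 0 \<le> z i" and f: "word_series Z f" and "\<And>z. z \<in> Z \<Longrightarrow> f z < 1" and "0 \<le> a"
  shows "word_series Z (\<lambda>z. (1 - f z) powr (- a))"
proof (rule word_series_sums[where f="\<lambda>k z. pochhammer a k / fact k * f z ^ k"])
  show "word_series Z (\<lambda>z. pochhammer a k / fact k * f z ^ k)" for k
  proof -
    have "0 \<le> pochhammer a k / fact k"
      using assms(4) by (simp add: pochhammer_prod prod_nonneg)
    then show ?thesis
      by (rule word_series_mult[OF Z word_series_const word_series_power[OF Z f]])
  qed
  fix z assume z: "z \<in> Z"
  have "\<bar>- f z\<bar> < 1" using assms(3)[OF z] word_series_nonneg[OF f z] by simp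
  from gen_binomial_real[OF this, of "- a"]
  show "(\<lambda>k. pochhammer a k / fact k * f z ^ k) sums (1 - f z) powr (- a)"
    by (simp add: gbinomial_pochhammer power_mult_distrib[symmetric] mult.assoc
        flip: power_mult_distrib) (simp add: power_minus' mult_ac)
qed

section \<open>Determinants by elimination of one variable\<close>

text \<open>Block factorization into a unit lower triangular matrix and a matrix whose first column
  vanishes below \<open>a 0 0\<close>; the remaining block of the second factor is the Schur
  complement.\<close>

lemma det_schur:
  fixes a :: "nat \<Rightarrow> nat \<Rightarrow> 'a :: field"
  assumes "a 0 0 \<noteq> 0"
  shows "Determinant.det (Matrix.mat (Suc n) (Suc n) (\<lambda>(i, j). a i j)) = a 0 0 *
    Determinant.det (Matrix.mat n n (\<lambda>(i, j). a (Suc i) (Suc j) - a (Suc i) 0 * a 0 (Suc j) / a 0 0))"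
proof -
  define A1 where "A1 = (1\<^sub>m 1 :: 'a Matrix.mat)"
  define C where "C = Matrix.mat n 1 (\<lambda>(i, j). a (Suc i) 0 / a 0 0)"
  define A2 where "A2 = Matrix.mat 1 1 (\<lambda>(i, j). a 0 0)"
  define R where "R = Matrix.mat 1 n (\<lambda>(i, j). a 0 (Suc j))"
  define D where "D = Matrix.mat n n (\<lambda>(i, j). a (Suc i) (Suc j) - a (Suc i) 0 * a 0 (Suc j) / a 0 0)"
  note defs = A1_def C_def A2_def R_def D_def
  have car: "A1 \<in> carrier_mat 1 1" "C \<in> carrier_mat n 1" "A2 \<in> carrier_mat 1 1"
    "R \<in> carrier_mat 1 n" "D \<in> carrier_mat n n"
    by (auto simp: defs)
  let ?L = "four_block_mat A1 (0\<^sub>m 1 n) C (1\<^sub>m n)"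
  let ?U = "four_block_mat A2 R (0\<^sub>m n 1) D"
  have CA: "C * A2 = Matrix.mat n 1 (\<lambda>(i, j). a (Suc i) 0)"
    using assms by (intro eq_matI) (auto simp: defs scalar_prod_def)
  have CR: "C * R + D = Matrix.mat n n (\<lambda>(i, j). a (Suc i) (Suc j))"
    by (intro eq_matI) (auto simp: defs scalar_prod_def)
  have "?L * ?U = four_block_mat (A1 * A2 + 0\<^sub>m 1 n * 0\<^sub>m n 1) (A1 * R + 0\<^sub>m 1 n * D)
      (C * A2 + 1\<^sub>m n * 0\<^sub>m n 1) (C * R + 1\<^sub>m n * D)"
    by (rule mult_four_block_mat) (use car in auto)
  also have "\<dots> = four_block_mat A2 R (C * A2) (C * R + D)"
    using car by (intro cong_four_block_mat) (simp_all add: A1_def CA)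
  also have "\<dots> = Matrix.mat (Suc n) (Suc n) (\<lambda>(i, j). a i j)"
    unfolding CA CR by (rule eq_matI) (auto simp: A2_def R_def)
  finally have "Determinant.det (Matrix.mat (Suc n) (Suc n) (\<lambda>(i, j). a i j)) =
      Determinant.det (?L * ?U)" by simp
  also have "\<dots> = Determinant.det ?L * Determinant.det ?U"
    by (rule det_mult[of _ "Suc n"]) (use car in auto)
  also have "Determinant.det ?L = 1"
    using car by (subst det_four_block_mat_upper_right_zero[of _ 1 _ n]) (auto simp: A1_def)
  also have "Determinant.det ?U = Determinant.det A2 * Determinant.det D"
    using car by (subst det_four_block_mat_lower_left_zero[of _ 1 _ n]) auto
  also have "Determinant.det A2 = a 0 0" by (simp add: A2_def det_single)
  finally show ?thesis by (simp add: D_def)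
qed

text \<open>The condition \<open>Q v < v\<close> passes to the Schur complement, whose entries are again word series.\<close>

lemma word_series_det_powr:
  assumes Z: "\<forall>z\<in>Z. \<forall>i. 0 \<le> z i" and a: "0 \<le> a"
    and "\<And>i j. i < n \<Longrightarrow> j < n \<Longrightarrow> word_series Z (Q i j)"
    and "\<And>i. i < n \<Longrightarrow> 0 < v i"
    and "\<And>z i. z \<in> Z \<Longrightarrow> i < n \<Longrightarrow> (\<Sum>j<n. Q i j z * v j) < (v i :: real)"
  shows "(\<forall>z\<in>Z. 0 < Determinant.det (Matrix.mat n n (\<lambda>(i, j). (if i = j then 1 else 0) - Q i j z))) \<and>
    word_series Z (\<lambda>z. Determinant.det (Matrix.mat n n (\<lambda>(i, j). (if i = j then 1 else 0) - Q i j z)) powr (- a))"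
  using assms(3-)
proof (induction n arbitrary: Q v)
  case 0
  have "Matrix.mat 0 0 (\<lambda>(i, j). (if i = j then 1 else 0) - Q i j z) = 1\<^sub>m 0" for z
    by (rule eq_matI) auto
  then show ?case by (simp add: word_series_const)
next
  case (Suc n)
  let ?q = "Q 0 0"
  \<comment> \<open>The Schur complement of \<open>I - Q\<close> is \<open>I - Q'\<close>. The
    quotient by \<open>1 - ?q z\<close> is written as a power with exponent -1 so that
    \<open>word_series_neg_powr\<close> covers it.\<close>
  define Q' where "Q' i j z = Q (Suc i) (Suc j) z + Q (Suc i) 0 z * Q 0 (Suc j) z * (1 - ?q z) powr (- 1)" for i j z
  note ws = Suc.prems(1)
  have nn: "0 \<le> Q i j z" if "z \<in> Z" "i < Suc n" "j < Suc n" for i j z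
    using word_series_nonneg[OF ws] that by auto
  have row: "Q i 0 z * v 0 + (\<Sum>j<n. Q i (Suc j) z * v (Suc j)) < v i" if "z \<in> Z" "i < Suc n" for i z
    using Suc.prems(3)[OF that] by (simp add: sum.lessThan_Suc_shift del: sum.lessThan_Suc)
  \<comment> \<open>This is the first row of \<open>Q v < v\<close> with its nonnegative
    off-diagonal terms dropped.\<close>
  have q1: "?q z < 1" if z: "z \<in> Z" for z
  proof -
    have "0 \<le> (\<Sum>j<n. Q 0 (Suc j) z * v (Suc j))"
      using nn[OF z] Suc.prems(2) by (intro sum_nonneg mult_nonneg_nonneg) (auto intro: less_imp_le)
    then have "?q z * v 0 < 1 * v 0" using row[OF z, of 0] by simp
    then show ?thesis using Suc.prems(2)[of 0] by (simp only: mult_less_cancel_right) auto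
  qed
  have Q'_eq: "Q' i j z = Q (Suc i) (Suc j) z + Q (Suc i) 0 z * Q 0 (Suc j) z / (1 - ?q z)" if "z \<in> Z" for i j z
    using q1[OF that] by (simp add: Q'_def powr_minus_divide)
  have IH: "(\<forall>z\<in>Z. 0 < Determinant.det (Matrix.mat n n (\<lambda>(i, j). (if i = j then 1 else 0) - Q' i j z))) \<and>
    word_series Z (\<lambda>z. Determinant.det (Matrix.mat n n (\<lambda>(i, j). (if i = j then 1 else 0) - Q' i j z)) powr (- a))"
  proof (rule Suc.IH[where v="\<lambda>i. v (Suc i)"])
    show "word_series Z (Q' i j)" if "i < n" "j < n" for i j
      unfolding Q'_def using that
      by (intro word_series_add word_series_mult word_series_neg_powr ws Z q1) auto
    show "0 < v (Suc i)" if "i < n" for i using Suc.prems(2) that by simp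
    fix z i assume z: "z \<in> Z" and i: "i < n"
    let ?S = "\<Sum>j<n. Q 0 (Suc j) z * v (Suc j)"
    have "(\<Sum>j<n. Q' i j z * v (Suc j)) =
        (\<Sum>j<n. Q (Suc i) (Suc j) z * v (Suc j)) + Q (Suc i) 0 z / (1 - ?q z) * ?S"
      unfolding Q'_eq[OF z] by (simp add: algebra_simps sum.distrib sum_distrib_left)
    \<comment> \<open>The first row bounds \<open>?S\<close> by a multiple of
      \<open>1 - ?q z\<close>, which cancels the denominator; what remains is row
      \<open>Suc i\<close> of the hypothesis.\<close>
    also have "?S \<le> (1 - ?q z) * v 0"
      using row[OF z, of 0] by (simp add: algebra_simps)
    then have "Q (Suc i) 0 z / (1 - ?q z) * ?S \<le> Q (Suc i) 0 z / (1 - ?q z) * ((1 - ?q z) * v 0)"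
      using nn[OF z, of "Suc i" 0] q1[OF z] i by (intro mult_left_mono) auto
    also have "\<dots> = Q (Suc i) 0 z * v 0" using q1[OF z] by simp
    finally show "(\<Sum>j<n. Q' i j z * v (Suc j)) < v (Suc i)"
      using row[OF z, of "Suc i"] i by simp
  qed
  have det: "Determinant.det (Matrix.mat (Suc n) (Suc n) (\<lambda>(i, j). (if i = j then 1 else 0) - Q i j z)) =
      (1 - ?q z) * Determinant.det (Matrix.mat n n (\<lambda>(i, j). (if i = j then 1 else 0) - Q' i j z))"
    if z: "z \<in> Z" for z
  proof -
    have "Determinant.det (Matrix.mat (Suc n) (Suc n) (\<lambda>(i, j). (if i = j then 1 else 0) - Q i j z)) =
      (1 - ?q z) * Determinant.det (Matrix.mat n n (\<lambda>(i, j). ((if Suc i = Suc j then 1 else 0) - Q (Suc i) (Suc j) z)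
        - ((if Suc i = 0 then 1 else 0) - Q (Suc i) 0 z) * ((if 0 = Suc j then 1 else 0) - Q 0 (Suc j) z) / (1 - ?q z)))"
      using det_schur[of "\<lambda>i j. (if i = j then 1 else 0) - Q i j z" n] q1[OF z] by simp
    then show ?thesis by (simp add: Q'_eq[OF z] algebra_simps)
  qed
  show ?case
  proof (intro conjI ballI)
    fix z assume z: "z \<in> Z"
    show "0 < Determinant.det (Matrix.mat (Suc n) (Suc n) (\<lambda>(i, j). (if i = j then 1 else 0) - Q i j z))"
      unfolding det[OF z] using q1[OF z] IH z by (intro mult_pos_pos) auto
  next
    have "word_series Z (\<lambda>z. (1 - ?q z) powr (- a) *
        Determinant.det (Matrix.mat n n (\<lambda>(i, j). (if i = j then 1 else 0) - Q' i j z)) powr (- a))"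
      using IH by (intro word_series_mult word_series_neg_powr Z ws q1 a) auto
    then show "word_series Z (\<lambda>z. Determinant.det (Matrix.mat (Suc n) (Suc n)
        (\<lambda>(i, j). (if i = j then 1 else 0) - Q i j z)) powr (- a))"
    proof (rule word_series_cong)
      fix z assume z: "z \<in> Z"
      \<comment> \<open>Positivity of the determinants is carried through the induction in order to
        split the power of this product.\<close>
      have "0 \<le> 1 - ?q z" "0 \<le> Determinant.det (Matrix.mat n n (\<lambda>(i, j). (if i = j then 1 else 0) - Q' i j z))"
        using q1[OF z] IH z by (auto intro: less_imp_le)
      then show "(1 - ?q z) powr (- a) * Determinant.det (Matrix.mat n n (\<lambda>(i, j). (if i = j then 1 else 0) - Q' i j z)) powr (- a) =
        Determinant.det (Matrix.mat (Suc n) (Suc n) (\<lambda>(i, j). (if i = j then 1 else 0) - Q i j z)) powr (- a)"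
        unfolding det[OF z] by (simp add: powr_mult)
    qed
  qed
qed

section \<open>Laplace transforms of permanental vectors as mixtures\<close>

lemma prod_list_map_count:
  fixes z :: "nat \<Rightarrow> real"
  assumes "\<And>i. n \<le> i \<Longrightarrow> z i = 1"
  shows "prod_list (map z w) = (\<Prod>i<n. z i ^ count_list w i)"
proof (induction w)
  case (Cons k w)
  have "(\<Prod>i<n. z i ^ count_list (k # w) i) = (\<Prod>i<n. (if i = k then z k else 1) * z i ^ count_list w i)"
    by (rule prod.cong) auto
  also have "\<dots> = (\<Prod>i<n. if i = k then z k else 1) * (\<Prod>i<n. z i ^ count_list w i)"
    by (rule prod.distrib)
  also have "(\<Prod>i<n. if i = k then z k else 1) = z k"
    using assms[of k] by simp
  finally show ?case using Cons by simp
qed simp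

text \<open>The hypothesis \<open>(I - h) K = diag d\<close> expresses that \<open>K\<close> is an inverse \<open>M\<close>-matrix. It turns
  \<open>I + K S\<close> into \<open>(I - h)\<^sup>-\<^sup>1 diag (1 + s d) (I - diag z h)\<close> with \<open>z = 1 / (1 + s d)\<close>.\<close>

lemma permanental_mixture:
  fixes h K :: "nat \<Rightarrow> nat \<Rightarrow> real" and d :: "nat \<Rightarrow> real"
  assumes h: "\<And>i j. i < n \<Longrightarrow> j < n \<Longrightarrow> 0 \<le> h i j"
    and K: "\<And>i j. i < n \<Longrightarrow> j < n \<Longrightarrow> 0 \<le> K i j" "\<And>i. i < n \<Longrightarrow> 0 < K i i"
    and d: "\<And>i. i < n \<Longrightarrow> 0 < d i"
    and hK: "\<And>i k. i < n \<Longrightarrow> k < n \<Longrightarrow> K i k - (\<Sum>j<n. h i j * K j k) = (if i = k then d i else 0)"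
    and a: "0 < a"
  obtains \<mu> :: "nat list pmf" where
    "\<And>s. (\<And>i. i < n \<Longrightarrow> 0 \<le> s i) \<Longrightarrow>
      ennreal (Determinant.det (1\<^sub>m n + Matrix.mat n n (\<lambda>(i, j). K i j) * mat_diag n s) powr (- a)) =
      (\<integral>\<^sup>+w. ennreal (\<Prod>i<n. (1 + s i * d i) powr (- (a + count_list w i))) \<partial>\<mu>)"
proof -
  define Z where "Z = {z :: nat \<Rightarrow> real. \<forall>i. 0 \<le> z i \<and> z i \<le> 1}"
  define M where "M z = Matrix.mat n n (\<lambda>(i, j). (if i = j then 1 else 0) - z i * h i j)" for z :: "nat \<Rightarrow> real"
  \<comment> \<open>This is \<open>K\<close> applied to the all-ones vector, so
    \<open>(I - h) K = diag d\<close> gives \<open>h v = v - d < v\<close>, the inequality that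
    \<open>word_series_det_powr\<close> asks for.\<close>
  define v where "v i = (\<Sum>k<n. K i k)" for i
  have v: "0 < v i" if "i < n" for i
    unfolding v_def using that K by (intro sum_pos2[of _ i]) auto
  have hv: "(\<Sum>j<n. h i j * v j) = v i - d i" if i: "i < n" for i
  proof -
    have "(\<Sum>k<n. K i k - (\<Sum>j<n. h i j * K j k)) = d i"
      using i hK[OF i] by simp
    moreover have "(\<Sum>k<n. \<Sum>j<n. h i j * K j k) = (\<Sum>j<n. h i j * v j)"
      unfolding v_def sum_distrib_left by (rule sum.swap)
    ultimately show ?thesis by (simp add: sum_subtractf v_def)
  qed
  have *: "(\<forall>z\<in>Z. 0 < Determinant.det (M z)) \<and> word_series Z (\<lambda>z. Determinant.det (M z) powr (- a))"
    unfolding M_def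
  proof (rule word_series_det_powr[where v=v])
    show "word_series Z (\<lambda>z. z i * h i j)" if "i < n" "j < n" for i j
      using h[OF that] by (intro word_series_mult[OF _ word_series_var word_series_const]) (auto simp: Z_def)
    fix z i assume z: "z \<in> Z" and i: "i < n"
    have "(\<Sum>j<n. z i * h i j * v j) = z i * (v i - d i)"
      using hv[OF i] by (simp add: sum_distrib_left[symmetric] mult.assoc)
    also have "\<dots> \<le> 1 * (v i - d i)"
    proof (rule mult_right_mono)
      have "0 \<le> (\<Sum>j<n. h i j * v j)" using h[OF i] v by (intro sum_nonneg mult_nonneg_nonneg) (auto intro: less_imp_le)
      then show "0 \<le> v i - d i" using hv[OF i] by simp
    qed (use z in \<open>auto simp: Z_def\<close>)
    finally show "(\<Sum>j<n. z i * h i j * v j) < v i" using d[OF i] by simp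
  qed (use a v in \<open>auto simp: Z_def\<close>)
  let ?m = "\<lambda>z w. ennreal (prod_list (map z w))"
  obtain c where c: "\<And>z. z \<in> Z \<Longrightarrow> ennreal (Determinant.det (M z) powr (- a)) =
      (\<integral>\<^sup>+w. c w * ?m z w \<partial>count_space UNIV)"
    using * unfolding word_series_def by metis
  \<comment> \<open>The matrix \<open>M (\<lambda>_. 1)\<close> is \<open>I - h\<close>; the factor
    \<open>D powr a\<close> below turns the coefficients into probabilities.\<close>
  define D where "D = Determinant.det (M (\<lambda>_. 1))"
  have one: "(\<lambda>_. 1) \<in> Z" by (simp add: Z_def)
  have D: "0 < D" unfolding D_def using * one by blast
  define p where "p w = ennreal (D powr a) * c w" for w
  have p_sum: "(\<integral>\<^sup>+w. p w * ?m z w \<partial>count_space UNIV) = ennreal (D powr a * Determinant.det (M z) powr (- a))"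
    if "z \<in> Z" for z
  proof -
    have "(\<integral>\<^sup>+w. p w * ?m z w \<partial>count_space UNIV) =
        ennreal (D powr a) * (\<integral>\<^sup>+w. c w * ?m z w \<partial>count_space UNIV)"
      unfolding p_def by (simp add: nn_integral_cmult mult.assoc)
    then show ?thesis using c[OF that] by (simp add: ennreal_mult')
  qed
  have "prod_list (map (\<lambda>_. 1::real) w) = 1" for w :: "nat list" by (induction w) auto
  then have total: "(\<integral>\<^sup>+w. p w \<partial>count_space UNIV) = 1"
    using p_sum[OF one] D by (simp add: D_def[symmetric] powr_minus)
  have p_le: "p w \<le> 1" for w
    using nn_integral_ge_point[of w UNIV p] total by simp
  have p_real: "ennreal (enn2real (p w)) = p w" for w
    using p_le[of w] by (intro ennreal_enn2real) (auto intro: le_less_trans)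
  define \<mu> where "\<mu> = embed_pmf (\<lambda>w. enn2real (p w))"
  have pmf: "ennreal (pmf \<mu> w) = p w" for w
    unfolding \<mu>_def by (subst pmf_embed_pmf) (auto simp: p_real total)
  show ?thesis
  proof (rule that[of \<mu>])
    fix s :: "nat \<Rightarrow> real" assume s: "\<And>i. i < n \<Longrightarrow> 0 \<le> s i"
    \<comment> \<open>The words of the series may contain letters outside \<open>{..<n}\<close>; the
      value 1 there makes them invisible.\<close>
    define z where "z i = (if i < n then 1 / (1 + s i * d i) else 1)" for i
    have pos: "0 < 1 + s i * d i" if "i < n" for i
      using s[OF that] d[OF that] by (simp add: add_pos_nonneg less_imp_le)
    have zc: "(1 + s i * d i) * z i = 1" if "i < n" for i
      using pos[OF that] that by (simp add: z_def)
    have z: "z \<in> Z"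
      unfolding Z_def
    proof (intro CollectI allI conjI)
      fix i
      show "0 \<le> z i" using pos[of i] by (simp add: z_def less_imp_le)
      have "0 \<le> s i * d i" if "i < n" using s[OF that] d[OF that] by simp
      then show "z i \<le> 1" using pos[of i] by (simp add: z_def)
    qed
    have [simp]: "dim_row (mat_diag n f) = n" "dim_col (mat_diag n f) = n" for f :: "nat \<Rightarrow> real"
      by (simp_all add: mat_diag_def)
    let ?K = "Matrix.mat n n (\<lambda>(i, j). K i j)"
    let ?S = "1\<^sub>m n + ?K * mat_diag n s"
    \<comment> \<open>Indeed
      \<open>(I - h) (I + K S) = I - h + diag d S = diag (1 + s d) - h\<close>, and
      \<open>diag (1 + s d) diag z = I\<close>.\<close>
    have "M (\<lambda>_. 1) * ?S = mat_diag n (\<lambda>i. 1 + s i * d i) * M z"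
    proof (rule eq_matI)
      fix i k assume "i < dim_row (mat_diag n (\<lambda>i. 1 + s i * d i) * M z)" "k < dim_col (mat_diag n (\<lambda>i. 1 + s i * d i) * M z)"
      then have ik: "i < n" "k < n" by (auto simp: M_def)
      have "?K * mat_diag n s = Matrix.mat n n (\<lambda>(i, j). K i j * s j)"
        by (subst mat_diag_mult_right[of _ n n]) auto
      then have S: "?S = Matrix.mat n n (\<lambda>(i, j). (if i = j then 1 else 0) + K i j * s j)"
        by (intro eq_matI) auto
      have "(M (\<lambda>_. 1) * ?S) $$ (i, k) =
          (\<Sum>j<n. ((if i = j then 1 else 0) - h i j) * ((if j = k then 1 else 0) + K j k * s k))"
        unfolding S using ik by (simp add: M_def scalar_prod_def atLeast0LessThan)
      also have "\<dots> = (\<Sum>j<n. (if i = j then (if i = k then 1 else 0) + K i k * s k else 0)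
          - (if j = k then h i k else 0) - h i j * K j k * s k)"
        by (rule sum.cong) (auto simp: algebra_simps)
      also have "\<dots> = (if i = k then 1 else 0) + K i k * s k - h i k - (\<Sum>j<n. h i j * K j k) * s k"
        using ik by (simp add: sum_subtractf sum_distrib_right)
      also have "\<dots> = (if i = k then 1 else 0) - h i k + (K i k - (\<Sum>j<n. h i j * K j k)) * s k"
        by (simp add: algebra_simps)
      also have "\<dots> = (1 + s i * d i) * ((if i = k then 1 else 0) - z i * h i k)"
      proof -
        have "(1 + s i * d i) * (z i * h i k) = h i k"
          using zc[OF ik(1)] by (simp only: mult.assoc[symmetric] mult_1_left)
        then show ?thesis unfolding hK[OF ik] by (simp only: right_diff_distrib) simp
      qed
      also have "\<dots> = (mat_diag n (\<lambda>i. 1 + s i * d i) * M z) $$ (i, k)"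
        using ik by (subst mat_diag_mult_left[of _ n n]) (auto simp: M_def)
      finally show "(M (\<lambda>_. 1) * ?S) $$ (i, k) = (mat_diag n (\<lambda>i. 1 + s i * d i) * M z) $$ (i, k)" .
    qed (auto simp: M_def)
    then have "Determinant.det (M (\<lambda>_. 1) * ?S) = Determinant.det (mat_diag n (\<lambda>i. 1 + s i * d i) * M z)"
      by simp
    moreover have "Determinant.det (M (\<lambda>_. 1) * ?S) = D * Determinant.det ?S"
      unfolding D_def by (rule det_mult[of _ n]) (auto simp: M_def)
    moreover have "Determinant.det (mat_diag n (\<lambda>i. 1 + s i * d i) * M z) =
        Determinant.det (mat_diag n (\<lambda>i. 1 + s i * d i)) * Determinant.det (M z)"
      by (rule det_mult[of _ n]) (auto simp: M_def)
    moreover have "Determinant.det (mat_diag n (\<lambda>i. 1 + s i * d i)) = (\<Prod>i<n. 1 + s i * d i)"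
      by (subst det_upper_triangular[of _ n]) (auto simp: diag_mat_def mat_diag_def prod.list_conv_set_nth atLeast0LessThan intro!: prod.cong)
    ultimately have "Determinant.det ?S = (\<Prod>i<n. 1 + s i * d i) * Determinant.det (M z) / D"
      using D by (simp add: field_simps)
    then have det: "Determinant.det ?S powr (- a) =
        (\<Prod>i<n. (1 + s i * d i) powr (- a)) * (D powr a * Determinant.det (M z) powr (- a))"
    proof -
      have "0 < Determinant.det (M z)" using * z by blast
      moreover have "0 < (\<Prod>i<n. 1 + s i * d i)" using pos by (intro prod_pos) auto
      moreover have "(\<Prod>i<n. 1 + s i * d i) powr (- a) = (\<Prod>i<n. (1 + s i * d i) powr (- a))"
        by (rule prod_powr_distrib)
      moreover have "inverse D powr (- a) = D powr a"
        using D by (simp add: powr_minus inverse_powr)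
      ultimately show ?thesis
        using \<open>Determinant.det ?S = _\<close> D by (simp add: powr_mult divide_inverse less_imp_le mult_ac)
    qed
    have trm: "ennreal (\<Prod>i<n. (1 + s i * d i) powr (- (a + count_list w i))) =
        ennreal (\<Prod>i<n. (1 + s i * d i) powr (- a)) * ?m z w" for w
    proof -
      have "(\<Prod>i<n. (1 + s i * d i) powr (- (a + count_list w i))) =
          (\<Prod>i<n. (1 + s i * d i) powr (- a) * z i ^ count_list w i)"
      proof (rule prod.cong[OF refl])
        fix i assume "i \<in> {..<n}"
        then have i: "i < n" by simp
        show "(1 + s i * d i) powr (- (a + count_list w i)) = (1 + s i * d i) powr (- a) * z i ^ count_list w i"
          using pos[OF i] i by (simp add: z_def powr_diff powr_realpow power_one_over field_simps)
      qed
      also have "\<dots> = (\<Prod>i<n. (1 + s i * d i) powr (- a)) * prod_list (map z w)"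
        by (subst prod_list_map_count[of n z]) (auto simp: z_def prod.distrib)
      finally show ?thesis by (simp add: ennreal_mult' prod_nonneg)
    qed
    have "(\<integral>\<^sup>+w. ennreal (\<Prod>i<n. (1 + s i * d i) powr (- (a + count_list w i))) \<partial>\<mu>) =
      (\<integral>\<^sup>+w. ennreal (\<Prod>i<n. (1 + s i * d i) powr (- a)) * (p w * ?m z w) \<partial>count_space UNIV)"
      unfolding nn_integral_measure_pmf pmf trm by (simp add: mult_ac)
    also have "\<dots> = ennreal (\<Prod>i<n. (1 + s i * d i) powr (- a)) * ennreal (D powr a * Determinant.det (M z) powr (- a))"
      by (simp add: nn_integral_cmult p_sum[OF z])
    also have "\<dots> = ennreal (Determinant.det ?S powr (- a))"
      unfolding det by (simp add: ennreal_mult' prod_nonneg)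
    finally show "ennreal (Determinant.det ?S powr (- a)) =
      (\<integral>\<^sup>+w. ennreal (\<Prod>i<n. (1 + s i * d i) powr (- (a + count_list w i))) \<partial>\<mu>)" ..
  qed
qed

section \<open>Mixtures of gamma distributions\<close>

lemma gamma_density_nonneg: "0 < a \<Longrightarrow> 0 \<le> gamma_density a x"
  by (simp add: gamma_density_def Gamma_real_pos less_imp_le)

lemma gamma_density_measurable [measurable]: "gamma_density a \<in> borel_measurable borel"
  unfolding gamma_density_def [abs_def] by measurable

abbreviation gamma_measure :: "real \<Rightarrow> real measure" where
  "gamma_measure a \<equiv> density lborel (\<lambda>x. ennreal (gamma_density a x))"

lemma nn_integral_gamma_measure_exp:
  assumes a: "0 < a" and s: "0 \<le> s"
  shows "(\<integral>\<^sup>+x. ennreal (exp (- (s * x))) \<partial>gamma_measure a) = ennreal ((1 + s) powr (- a))"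
proof -
  \<comment> \<open>Scaling the variable by \<open>c\<close> turns the exponent
    \<open>(1 + s) * x\<close> into \<open>x\<close>, leaving the integral for
    \<open>Gamma a\<close>.\<close>
  define c where "c = 1 / (1 + s)"
  have c: "0 < c" "c + s * c = 1" using s by (auto simp: c_def field_simps)
  have G: "0 < Gamma a" using a by (rule Gamma_real_pos)
  have dens: "gamma_density a (0 + c * x) * exp (- (s * (0 + c * x))) =
      c powr (a - 1) / Gamma a * (indicator {0..} x * x powr (a - 1) / exp x)" for x
  proof (cases "0 < x")
    case True
    have "exp (- (c * x)) * exp (- (s * (c * x))) = exp (- ((c + s * c) * x))"
      by (simp add: mult_exp_exp algebra_simps)
    then have e: "exp (- (c * x)) * exp (- (s * (c * x))) = 1 / exp x"
      unfolding c(2) by (simp add: exp_minus inverse_eq_divide)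
    have "gamma_density a (0 + c * x) * exp (- (s * (0 + c * x))) =
        (c * x) powr (a - 1) / Gamma a * (exp (- (c * x)) * exp (- (s * (c * x))))"
      using True c(1) by (simp add: gamma_density_def)
    then show ?thesis
      unfolding e using True c(1) by (simp add: powr_mult)
  next
    case False
    \<comment> \<open>At \<open>x = 0\<close> the indicator is 1, yet both sides vanish because
      \<open>0 powr y = 0\<close>.\<close>
    then show ?thesis using c(1) by (cases "x = 0") (auto simp: gamma_density_def zero_less_mult_iff)
  qed
  have "(\<integral>\<^sup>+x. ennreal (exp (- (s * x))) \<partial>gamma_measure a) =
      (\<integral>\<^sup>+x. ennreal (gamma_density a x) * ennreal (exp (- (s * x))) \<partial>lborel)"
    by (simp add: nn_integral_density)
  also have "\<dots> = (\<integral>\<^sup>+x. ennreal (gamma_density a x * exp (- (s * x))) \<partial>lborel)"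
    using a by (intro nn_integral_cong) (simp add: ennreal_mult' gamma_density_nonneg)
  also have "\<dots> = ennreal c *
      (\<integral>\<^sup>+x. ennreal (gamma_density a (0 + c * x) * exp (- (s * (0 + c * x)))) \<partial>lborel)"
    using c(1) by (subst nn_integral_real_affine[where c=c and t=0]) auto
  also have "\<dots> = ennreal c * (\<integral>\<^sup>+x. ennreal (c powr (a - 1) / Gamma a) *
      ennreal (indicator {0..} x * x powr (a - 1) / exp x) \<partial>lborel)"
    unfolding dens using G by (simp add: ennreal_mult' del: times_divide_eq_left times_divide_eq_right)
  also have "\<dots> = ennreal c * (ennreal (c powr (a - 1) / Gamma a) * ennreal (Gamma a))"
    unfolding Gamma_conv_nn_integral_real[OF a] by (subst nn_integral_cmult) auto
  also have "\<dots> = ennreal (c * (c powr (a - 1) / Gamma a * Gamma a))"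
    using G c(1) by (simp add: ennreal_mult'[symmetric] del: times_divide_eq_left)
  also have "c * (c powr (a - 1) / Gamma a * Gamma a) = c powr 1 * c powr (a - 1)"
    using G c(1) by simp
  also have "\<dots> = c powr a" by (simp only: powr_add[symmetric]) simp
  also have "\<dots> = (1 + s) powr (- a)" using s by (simp add: c_def powr_divide powr_minus_divide)
  finally show ?thesis .
qed

lemma prob_space_gamma_measure:
  assumes "0 < a"
  shows "prob_space (gamma_measure a)"
proof
  show "emeasure (gamma_measure a) (space (gamma_measure a)) = 1"
    using nn_integral_gamma_measure_exp[OF assms, of 0] by simp
qed

text \<open>The density of \<open>gamma_measure (a + k)\<close> with respect to \<open>gamma_measure a\<close> is proportional to \<open>x powr k\<close>,
  hence at most its value at \<open>c\<close> on \<open>{..<c}\<close> and at least that value on \<open>{c..}\<close>.\<close>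

lemma gamma_measure_shape_mono:
  assumes a: "0 < a" and k: "0 \<le> k" and c: "0 < c"
  shows "measure (gamma_measure (a + k)) {..<c} \<le> measure (gamma_measure a) {..<c}"
proof -
  let ?g = "gamma_measure a"
  interpret A: prob_space ?g by (rule prob_space_gamma_measure[OF a])
  interpret B: prob_space "gamma_measure (a + k)" using a k by (intro prob_space_gamma_measure) simp
  define r where "r = Gamma a / Gamma (a + k)"
  have r: "0 < r" using a k by (simp add: r_def Gamma_real_pos)
  have dens: "gamma_density (a + k) x = gamma_density a x * (r * x powr k)" for x
  proof (cases "0 < x")
    case True
    then have "x powr (a + k - 1) = x powr (a - 1) * x powr k" by (simp add: powr_add[symmetric] algebra_simps)
    then show ?thesis using True a k by (simp add: gamma_density_def r_def Gamma_real_pos less_imp_neq[symmetric])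
  qed (simp add: gamma_density_def)
  have em: "emeasure (gamma_measure (a + k)) C = (\<integral>\<^sup>+x\<in>C. ennreal (r * x powr k) \<partial>?g)" if [measurable]: "C \<in> sets borel" for C
  proof -
    have "emeasure (gamma_measure (a + k)) C = (\<integral>\<^sup>+x. ennreal (gamma_density (a + k) x) * indicator C x \<partial>lborel)"
      using that by (simp add: emeasure_density)
    also have "\<dots> = (\<integral>\<^sup>+x. ennreal (gamma_density a x) * (ennreal (r * x powr k) * indicator C x) \<partial>lborel)"
      using a r unfolding dens by (intro nn_integral_cong) (simp add: ennreal_mult gamma_density_nonneg mult_ac)
    also have "\<dots> = (\<integral>\<^sup>+x\<in>C. ennreal (r * x powr k) \<partial>?g)"
      by (subst nn_integral_density) simp_all
    finally show ?thesis .
  qed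
  have pos: "AE x in ?g. 0 \<le> x"
    using a by (subst AE_density) (auto simp: gamma_density_def)
  let ?t = "r * c powr k"
  have t: "0 < ?t" using r c by simp
  have "emeasure (gamma_measure (a + k)) {..<c} \<le> (\<integral>\<^sup>+x. ennreal ?t * indicator {..<c} x \<partial>?g)"
    unfolding em[of "{..<c}", simplified] using pos
  proof (intro nn_integral_mono_AE, eventually_elim)
    case (elim x)
    then show ?case
      using r k by (auto simp: indicator_def intro!: ennreal_leI mult_left_mono powr_mono2)
  qed
  also have "\<dots> = ennreal (?t * measure ?g {..<c})"
    using t by (subst nn_integral_cmult_indicator) (auto simp: A.emeasure_eq_measure ennreal_mult')
  finally have 1: "measure (gamma_measure (a + k)) {..<c} \<le> ?t * measure ?g {..<c}"
    using t by (simp add: B.emeasure_eq_measure)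
  have "ennreal (?t * measure ?g {c..}) = (\<integral>\<^sup>+x. ennreal ?t * indicator {c..} x \<partial>?g)"
    using t by (subst nn_integral_cmult_indicator) (auto simp: A.emeasure_eq_measure ennreal_mult')
  also have "\<dots> \<le> emeasure (gamma_measure (a + k)) {c..}"
    unfolding em[of "{c..}", simplified]
    using r k c by (intro nn_integral_mono) (auto simp: indicator_def intro!: ennreal_leI mult_left_mono powr_mono2)
  finally have 2: "?t * measure ?g {c..} \<le> measure (gamma_measure (a + k)) {c..}"
    using t by (simp add: B.emeasure_eq_measure)
  have cA: "measure ?g {c..} = 1 - measure ?g {..<c}"
    using A.prob_compl[of "{..<c}"] by (simp add: Compl_eq_Diff_UNIV[symmetric] not_less Compl_lessThan)
  have cB: "measure (gamma_measure (a + k)) {c..} = 1 - measure (gamma_measure (a + k)) {..<c}"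
    using B.prob_compl[of "{..<c}"] by (simp add: Compl_eq_Diff_UNIV[symmetric] not_less Compl_lessThan)
  define p q where "p = measure ?g {..<c}" and "q = measure (gamma_measure (a + k)) {..<c}"
  have pq: "0 \<le> p" "p \<le> 1" "q \<le> ?t * p" "?t * (1 - p) \<le> 1 - q"
    using 1 2 unfolding cA cB p_def q_def by auto
  \<comment> \<open>The bounds on the two half-lines are multiplied by \<open>1 - p\<close> and
    \<open>p\<close>, so that \<open>?t\<close> is eliminated between them.\<close>
  have "q * (1 - p) \<le> (?t * p) * (1 - p)" using pq by (intro mult_right_mono) auto
  also have "\<dots> = p * (?t * (1 - p))" by simp
  also have "\<dots> \<le> p * (1 - q)" using pq by (intro mult_left_mono) auto
  finally have "q \<le> p" by (simp add: algebra_simps)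
  then show ?thesis unfolding p_def q_def .
qed

text \<open>Applied to \<open>exp (- X)\<close>, the conclusion \<open>box_prob_eq\<close> replaces the uniqueness theorem for
  multivariate Laplace transforms.\<close>

locale equal_moments = M1?: prob_space M1 + M2?: prob_space M2 for M1 :: "'x measure" and M2 :: "'y measure" +
  fixes I :: "'i set" and Y1 :: "'i \<Rightarrow> 'x \<Rightarrow> real" and Y2 :: "'i \<Rightarrow> 'y \<Rightarrow> real"
  assumes finite_I: "finite I"
    and Y1_measurable [measurable]: "\<And>i. i \<in> I \<Longrightarrow> Y1 i \<in> borel_measurable M1"
    and Y2_measurable [measurable]: "\<And>i. i \<in> I \<Longrightarrow> Y2 i \<in> borel_measurable M2"
    and Y1_unit: "\<And>i \<omega>. i \<in> I \<Longrightarrow> \<omega> \<in> space M1 \<Longrightarrow> Y1 i \<omega> \<in> {0..1}"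
    and Y2_unit: "\<And>i \<omega>. i \<in> I \<Longrightarrow> \<omega> \<in> space M2 \<Longrightarrow> Y2 i \<omega> \<in> {0..1}"
    and moments: "\<And>k :: 'i \<Rightarrow> nat. (LINT \<omega>|M1. (\<Prod>i\<in>I. Y1 i \<omega> ^ k i)) = (LINT \<omega>|M2. (\<Prod>i\<in>I. Y2 i \<omega> ^ k i))"
begin

text \<open>A single function for all coordinates is enough because only cubes are to be compared.
  All approximations thus stay one-dimensional.\<close>

definition same_expectation :: "(real \<Rightarrow> real) \<Rightarrow> bool" where
  "same_expectation h \<longleftrightarrow> h \<in> borel_measurable borel \<and>
     (LINT \<omega>|M1. (\<Prod>i\<in>I. h (Y1 i \<omega>))) = (LINT \<omega>|M2. (\<Prod>i\<in>I. h (Y2 i \<omega>)))"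

text \<open>The product over the coordinates expands into mixed monomials, whose expectations agree
  by \<open>moments\<close>.\<close>

lemma same_expectation_polynomial: "same_expectation (\<lambda>y. \<Sum>k\<le>N. c k * y ^ k)"
  unfolding same_expectation_def
proof
  have expand: "(\<Prod>i\<in>I. \<Sum>k\<le>N. c k * y i ^ k) = (\<Sum>f\<in>PiE I (\<lambda>_. {..N}). (\<Prod>i\<in>I. c (f i)) * (\<Prod>i\<in>I. y i ^ f i))" for y :: "'i \<Rightarrow> real"
    using finite_I by (subst prod_sum_PiE) (auto simp: prod.distrib)
  have int1: "integrable M1 (\<lambda>\<omega>. \<Prod>i\<in>I. Y1 i \<omega> ^ k i)" for k :: "'i \<Rightarrow> nat"
  proof (rule M1.integrable_const_bound[where B=1])
    show "AE \<omega> in M1. norm (\<Prod>i\<in>I. Y1 i \<omega> ^ k i) \<le> 1"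
      using Y1_unit by (intro AE_I2) (auto simp: abs_prod intro!: prod_le_1 power_le_one)
  qed measurable
  have int2: "integrable M2 (\<lambda>\<omega>. \<Prod>i\<in>I. Y2 i \<omega> ^ k i)" for k :: "'i \<Rightarrow> nat"
  proof (rule M2.integrable_const_bound[where B=1])
    show "AE \<omega> in M2. norm (\<Prod>i\<in>I. Y2 i \<omega> ^ k i) \<le> 1"
      using Y2_unit by (intro AE_I2) (auto simp: abs_prod intro!: prod_le_1 power_le_one)
  qed measurable
  show "(LINT \<omega>|M1. (\<Prod>i\<in>I. \<Sum>k\<le>N. c k * Y1 i \<omega> ^ k)) = (LINT \<omega>|M2. (\<Prod>i\<in>I. \<Sum>k\<le>N. c k * Y2 i \<omega> ^ k))"
    unfolding expand using int1 int2 by (simp add: Bochner_Integration.integral_sum moments)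
qed measurable

lemma same_expectation_limit:
  assumes h: "\<And>m. same_expectation (h m)" and [measurable]: "g \<in> borel_measurable borel"
    and lim: "\<And>y. y \<in> {0..1} \<Longrightarrow> (\<lambda>m. h m y) \<longlonglongrightarrow> g y"
    and bound: "\<And>m y. y \<in> {0..1} \<Longrightarrow> \<bar>h m y\<bar> \<le> C"
  shows "same_expectation g"
  unfolding same_expectation_def
proof
  have [measurable]: "h m \<in> borel_measurable borel" for m using h by (simp add: same_expectation_def)
  have b: "norm (\<Prod>i\<in>I. h m (y i)) \<le> C ^ card I" if "\<And>i. i \<in> I \<Longrightarrow> y i \<in> {0..1}" for m y
    using bound[OF that] by (auto simp: abs_prod intro!: prod_le_power[THEN order_trans] simp flip: prod_constant intro!: prod_mono)
  have "(\<lambda>m. LINT \<omega>|M1. (\<Prod>i\<in>I. h m (Y1 i \<omega>))) \<longlonglongrightarrow> (LINT \<omega>|M1. (\<Prod>i\<in>I. g (Y1 i \<omega>)))"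
  proof (rule integral_dominated_convergence[where w="\<lambda>_. C ^ card I"])
    show "AE \<omega> in M1. (\<lambda>m. \<Prod>i\<in>I. h m (Y1 i \<omega>)) \<longlonglongrightarrow> (\<Prod>i\<in>I. g (Y1 i \<omega>))"
      using Y1_unit by (intro AE_I2 tendsto_prod lim) auto
    show "AE \<omega> in M1. norm (\<Prod>i\<in>I. h m (Y1 i \<omega>)) \<le> C ^ card I" for m
      using Y1_unit by (intro AE_I2 b) auto
  qed auto
  moreover have "(\<lambda>m. LINT \<omega>|M2. (\<Prod>i\<in>I. h m (Y2 i \<omega>))) \<longlonglongrightarrow> (LINT \<omega>|M2. (\<Prod>i\<in>I. g (Y2 i \<omega>)))"
  proof (rule integral_dominated_convergence[where w="\<lambda>_. C ^ card I"])
    show "AE \<omega> in M2. (\<lambda>m. \<Prod>i\<in>I. h m (Y2 i \<omega>)) \<longlonglongrightarrow> (\<Prod>i\<in>I. g (Y2 i \<omega>))"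
      using Y2_unit by (intro AE_I2 tendsto_prod lim) auto
    show "AE \<omega> in M2. norm (\<Prod>i\<in>I. h m (Y2 i \<omega>)) \<le> C ^ card I" for m
      using Y2_unit by (intro AE_I2 b) auto
  qed auto
  moreover have "(LINT \<omega>|M1. (\<Prod>i\<in>I. h m (Y1 i \<omega>))) = (LINT \<omega>|M2. (\<Prod>i\<in>I. h m (Y2 i \<omega>)))" for m
    using h by (simp add: same_expectation_def)
  ultimately show "(LINT \<omega>|M1. (\<Prod>i\<in>I. g (Y1 i \<omega>))) = (LINT \<omega>|M2. (\<Prod>i\<in>I. g (Y2 i \<omega>)))"
    using LIMSEQ_unique by force
qed fact

lemma same_expectation_continuous:
  assumes g: "continuous_on UNIV g" and unit: "\<And>y. \<bar>g y\<bar> \<le> 1"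
  shows "same_expectation g"
proof -
  have "\<exists>q. real_polynomial_function q \<and> (\<forall>y\<in>{0..1}. \<bar>g y - q y\<bar> < inverse (Suc m))" for m
    using Stone_Weierstrass_real_polynomial_function[of "{0..1::real}" g "inverse (Suc m)"]
      continuous_on_subset[OF g] by (metis compact_Icc inverse_Suc subset_UNIV)
  then obtain q where q: "\<And>m. real_polynomial_function (q m)"
    "\<And>m y. y \<in> {0..1} \<Longrightarrow> \<bar>g y - q m y\<bar> < inverse (Suc m)"
    by metis
  show ?thesis
  \<comment> \<open>The bound 2 is the bound 1 for \<open>g\<close> plus an approximation error of
    at most 1.\<close>
  proof (rule same_expectation_limit[where h=q and C=2])
    show "same_expectation (q m)" for m
      using q(1)[of m] same_expectation_polynomial by (auto simp: real_polynomial_function_iff_sum)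
    show "g \<in> borel_measurable borel" by (rule borel_measurable_continuous_onI[OF g])
    fix y :: real assume y: "y \<in> {0..1}"
    show "(\<lambda>m. q m y) \<longlonglongrightarrow> g y"
    proof (rule Lim_null[THEN iffD2], rule Lim_null_comparison[OF _ LIMSEQ_inverse_real_of_nat])
      show "\<forall>\<^sub>F m in sequentially. norm (q m y - g y) \<le> inverse (real (Suc m))"
        using q(2)[OF y] by (intro always_eventually allI) (auto simp: abs_minus_commute intro: less_imp_le)
    qed
  next
    fix m and y :: real assume y: "y \<in> {0..1}"
    fix m
    have "inverse (real (Suc m)) \<le> 1" by (simp add: field_simps)
    then show "\<bar>q m y\<bar> \<le> 2" using q(2)[OF y, of m] unit[of y] by linarith
  qed
qed

lemma box_prob_eq:
  "measure M1 {\<omega>\<in>space M1. \<forall>i\<in>I. c < Y1 i \<omega>} = measure M2 {\<omega>\<in>space M2. \<forall>i\<in>I. c < Y2 i \<omega>}"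
proof -
  \<comment> \<open>Ramps of slope \<open>m\<close> that start at \<open>c\<close>. They vanish at
    \<open>c\<close> itself, so the limit is the indicator of the open half-line.\<close>
  define h where "h m y = min 1 (max 0 (real m * (y - c)))" for m y
  have same: "same_expectation (indicator {c<..} :: real \<Rightarrow> real)"
  proof (rule same_expectation_limit[where h=h and C=1])
    show "same_expectation (h m)" for m
      unfolding h_def by (rule same_expectation_continuous) (auto intro!: continuous_intros)
    show "\<bar>h m y\<bar> \<le> 1" for m y by (simp add: h_def)
    fix y :: real
    show "(\<lambda>m. h m y) \<longlonglongrightarrow> indicator {c<..} y"
    proof (cases "c < y")
      case True
      obtain N where N: "1 < real N * (y - c)"
        using reals_Archimedean3[of "y - c"] True by (auto simp: diff_gt_0_iff_gt)
      have "h m y = 1" if "N \<le> m" for m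
      proof -
        have "real N * (y - c) \<le> real m * (y - c)" using that True by (intro mult_right_mono) auto
        then show ?thesis using N by (simp add: h_def)
      qed
      then have "(\<lambda>m. h m y) \<longlonglongrightarrow> 1" by (intro tendsto_eventually) (auto simp: eventually_sequentially)
      then show ?thesis using True by simp
    next
      case False
      then have "h m y = 0" for m by (simp add: h_def mult_nonneg_nonpos)
      then show ?thesis using False by simp
    qed
  qed measurable
  have ind: "(\<Prod>i\<in>I. indicator {c<..} (y i)) = (if \<forall>i\<in>I. c < y i then 1 else 0 :: real)" for y
    using finite_I by (auto simp: indicator_def prod_zero_iff)
  have 1: "(LINT \<omega>|M1. (\<Prod>i\<in>I. indicat_real {c<..} (Y1 i \<omega>))) = measure M1 {\<omega>\<in>space M1. \<forall>i\<in>I. c < Y1 i \<omega>}"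
  proof -
    have "(LINT \<omega>|M1. (\<Prod>i\<in>I. indicat_real {c<..} (Y1 i \<omega>))) = (LINT \<omega>|M1. indicator {\<omega>\<in>space M1. \<forall>i\<in>I. c < Y1 i \<omega>} \<omega>)"
      unfolding ind by (rule Bochner_Integration.integral_cong[OF refl]) (auto simp: indicator_def prod_zero_iff finite_I)
    also have "\<dots> = measure M1 ({\<omega>\<in>space M1. \<forall>i\<in>I. c < Y1 i \<omega>} \<inter> space M1)"
      by (rule Bochner_Integration.integral_indicator)
    finally show ?thesis by (simp add: Int_def conj_commute)
  qed
  have 2: "(LINT \<omega>|M2. (\<Prod>i\<in>I. indicat_real {c<..} (Y2 i \<omega>))) = measure M2 {\<omega>\<in>space M2. \<forall>i\<in>I. c < Y2 i \<omega>}"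
  proof -
    have "(LINT \<omega>|M2. (\<Prod>i\<in>I. indicat_real {c<..} (Y2 i \<omega>))) = (LINT \<omega>|M2. indicator {\<omega>\<in>space M2. \<forall>i\<in>I. c < Y2 i \<omega>} \<omega>)"
      unfolding ind by (rule Bochner_Integration.integral_cong[OF refl]) (auto simp: indicator_def prod_zero_iff finite_I)
    also have "\<dots> = measure M2 ({\<omega>\<in>space M2. \<forall>i\<in>I. c < Y2 i \<omega>} \<inter> space M2)"
      by (rule Bochner_Integration.integral_indicator)
    finally show ?thesis by (simp add: Int_def conj_commute)
  qed
  show ?thesis using same unfolding same_expectation_def 1 2 by simp
qed

end

section \<open>Comparison of a gamma mixture with independent gamma variables\<close>

text \<open>The mixture is realized as \<open>M2\<close>: draw a word from \<mu>, then independent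
  gamma coordinates with the shapes it prescribes. At natural \<open>s\<close> the hypothesis
  equates moments, so the box has the same probability under \<open>M2\<close>. Given the word, that
  probability factorizes, and each factor is bounded by
  \<open>gamma_measure_shape_mono\<close>.\<close>

lemma gamma_mixture_box_le:
  fixes \<mu> :: "nat list pmf" and X :: "nat \<Rightarrow> 'b \<Rightarrow> real" and a c :: real
  assumes "prob_space M" and I: "finite I" and a: "0 < a" and c: "0 < c"
    and X [measurable]: "\<And>i. i \<in> I \<Longrightarrow> X i \<in> borel_measurable M"
    and X_nonneg: "\<And>i \<omega>. i \<in> I \<Longrightarrow> \<omega> \<in> space M \<Longrightarrow> 0 \<le> X i \<omega>"
    and lt: "\<And>s. (\<And>i. i \<in> I \<Longrightarrow> 0 \<le> s i) \<Longrightarrow> ennreal (LINT \<omega>|M. exp (- (\<Sum>i\<in>I. s i * X i \<omega>))) =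
      (\<integral>\<^sup>+w. ennreal (\<Prod>i\<in>I. (1 + s i) powr (- (a + real (count_list w i)))) \<partial>\<mu>)"
  shows "measure M {\<omega>\<in>space M. \<forall>i\<in>I. X i \<omega> < c} \<le> measure (gamma_measure a) {..<c} ^ card I"
proof -
  interpret M: prob_space M by fact
  interpret Ga: prob_space "gamma_measure a" by (rule prob_space_gamma_measure[OF a])
  let ?B = "PiM I (\<lambda>_. borel :: real measure)"
  define g where "g w i = gamma_measure (a + real (count_list w i))" for w and i :: nat
  define N where "N w = PiM I (g w)" for w
  have g: "prob_space (g w i)" for w i
    unfolding g_def using a by (intro prob_space_gamma_measure) simp
  have [simp]: "sets (g w i) = sets borel" "space (g w i) = UNIV" for w i by (simp_all add: g_def)
  have sets_N: "sets (N w) = sets ?B" for w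
    unfolding N_def by (intro sets_PiM_cong) auto
  have N_prob: "prob_space (N w)" for w
    unfolding N_def using g by (intro prob_space_PiM)
  have N_meas: "N \<in> measure_pmf \<mu> \<rightarrow>\<^sub>M prob_algebra ?B"
    using N_prob sets_N by (simp add: space_prob_algebra Pi_def)
  have N_sub: "N \<in> measure_pmf \<mu> \<rightarrow>\<^sub>M subprob_algebra ?B"
    by (rule measurable_prob_algebraD[OF N_meas])
  have mu: "measure_pmf \<mu> \<in> space (prob_algebra (measure_pmf \<mu>))"
    by (simp add: space_prob_algebra measure_pmf.prob_space_axioms)
  define M2 where "M2 = bind (measure_pmf \<mu>) N"
  have M2: "prob_space M2" unfolding M2_def by (rule prob_space_bind'[OF mu N_meas])
  interpret M2: prob_space M2 by (rule M2)
  have sets_M2 [measurable_cong]: "sets M2 = sets ?B" unfolding M2_def by (rule sets_bind'[OF mu N_meas])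
  have space_M2: "space M2 = PiE I (\<lambda>_. UNIV)"
    using sets_eq_imp_space_eq[OF sets_M2] by (simp add: space_PiM)
  have g_exp: "(\<integral>\<^sup>+x. ennreal (exp (- max 0 x) ^ k) \<partial>g w i) = ennreal ((1 + real k) powr (- (a + real (count_list w i))))" for w i k
  proof -
    have "AE x in g w i. 0 \<le> x"
      unfolding g_def by (subst AE_density) (auto simp: gamma_density_def)
    then have "(\<integral>\<^sup>+x. ennreal (exp (- max 0 x) ^ k) \<partial>g w i) = (\<integral>\<^sup>+x. ennreal (exp (- (real k * x))) \<partial>g w i)"
      by (intro nn_integral_cong_AE) (auto elim!: eventually_mono simp: exp_of_nat_mult[symmetric] max_def)
    then show ?thesis
      unfolding g_def using a by (subst (asm) nn_integral_gamma_measure_exp) auto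
  qed
  \<comment> \<open>\<open>max 0\<close>, since the coordinates are nonnegative only almost surely under \<open>M2\<close>\<close>
  interpret EM: equal_moments M M2 I "\<lambda>i \<omega>. exp (- X i \<omega>)" "\<lambda>i \<omega>. exp (- max 0 (\<omega> i))"
  proof (intro equal_moments.intro equal_moments_axioms.intro)
    show "finite I" "prob_space M" "prob_space M2" by (fact assms(1) I M2)+
    show "(\<lambda>\<omega>. exp (- X i \<omega>)) \<in> borel_measurable M" if "i \<in> I" for i
      using that by measurable
    show Y2: "(\<lambda>\<omega>. exp (- max 0 (\<omega> i))) \<in> borel_measurable M2" if "i \<in> I" for i
      using that by measurable
    show "exp (- X i \<omega>) \<in> {0..1}" if "i \<in> I" "\<omega> \<in> space M" for i \<omega>
      using X_nonneg[OF that] by simp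
    show "exp (- max 0 (\<omega> i)) \<in> {0..1}" for \<omega> :: "nat \<Rightarrow> real" and i by simp
    fix k :: "nat \<Rightarrow> nat"
    have "(LINT \<omega>|M. (\<Prod>i\<in>I. exp (- X i \<omega>) ^ k i)) = (LINT \<omega>|M. exp (- (\<Sum>i\<in>I. real (k i) * X i \<omega>)))"
      using I by (simp add: exp_of_nat_mult[symmetric] exp_sum[symmetric] sum_negf)
    then have 1: "ennreal (LINT \<omega>|M. (\<Prod>i\<in>I. exp (- X i \<omega>) ^ k i)) =
        (\<integral>\<^sup>+w. ennreal (\<Prod>i\<in>I. (1 + real (k i)) powr (- (a + real (count_list w i)))) \<partial>\<mu>)"
      using lt[of "\<lambda>i. real (k i)"] by simp
    have int: "integrable M2 (\<lambda>\<omega>. \<Prod>i\<in>I. exp (- max 0 (\<omega> i)) ^ k i)"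
    proof (rule M2.integrable_const_bound[where B=1])
      show "AE \<omega> in M2. norm (\<Prod>i\<in>I. exp (- max 0 (\<omega> i)) ^ k i) \<le> 1"
        by (intro AE_I2) (auto simp: abs_prod intro!: prod_le_1 power_le_one)
    qed (use Y2 in measurable)
    have "ennreal (LINT \<omega>|M2. (\<Prod>i\<in>I. exp (- max 0 (\<omega> i)) ^ k i)) =
        (\<integral>\<^sup>+\<omega>. ennreal (\<Prod>i\<in>I. exp (- max 0 (\<omega> i)) ^ k i) \<partial>M2)"
      by (rule nn_integral_eq_integral[symmetric, OF int]) (auto intro!: prod_nonneg)
    also have "\<dots> = (\<integral>\<^sup>+w. \<integral>\<^sup>+\<omega>. ennreal (\<Prod>i\<in>I. exp (- max 0 (\<omega> i)) ^ k i) \<partial>N w \<partial>\<mu>)"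
      unfolding M2_def by (rule nn_integral_bind[OF _ N_sub]) measurable
    also have "\<dots> = (\<integral>\<^sup>+w. ennreal (\<Prod>i\<in>I. (1 + real (k i)) powr (- (a + real (count_list w i)))) \<partial>\<mu>)"
    proof (rule nn_integral_cong)
      fix w
      interpret gw: product_prob_space "g w" I
        by (intro product_prob_space.intro product_prob_space_axioms.intro product_sigma_finite.intro g
            prob_space_imp_sigma_finite)
      have "(\<integral>\<^sup>+\<omega>. ennreal (\<Prod>i\<in>I. exp (- max 0 (\<omega> i)) ^ k i) \<partial>N w) =
          (\<integral>\<^sup>+\<omega>. (\<Prod>i\<in>I. ennreal (exp (- max 0 (\<omega> i)) ^ k i)) \<partial>N w)"
        by (simp add: prod_ennreal)
      also have "\<dots> = (\<Prod>i\<in>I. \<integral>\<^sup>+x. ennreal (exp (- max 0 x) ^ k i) \<partial>g w i)"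
        unfolding N_def using I by (intro gw.product_nn_integral_prod) (auto cong: measurable_cong_sets)
      also have "\<dots> = ennreal (\<Prod>i\<in>I. (1 + real (k i)) powr (- (a + real (count_list w i))))"
        unfolding g_exp by (simp add: prod_ennreal)
      finally show "(\<integral>\<^sup>+\<omega>. ennreal (\<Prod>i\<in>I. exp (- max 0 (\<omega> i)) ^ k i) \<partial>N w) = \<dots>" .
    qed
    finally show "(LINT \<omega>|M. (\<Prod>i\<in>I. exp (- X i \<omega>) ^ k i)) = (LINT \<omega>|M2. (\<Prod>i\<in>I. exp (- max 0 (\<omega> i)) ^ k i))"
      unfolding 1[symmetric] by (subst (asm) ennreal_inj) (auto intro!: Bochner_Integration.integral_nonneg prod_nonneg)
  qed
  have "measure M {\<omega>\<in>space M. \<forall>i\<in>I. X i \<omega> < c} = measure M {\<omega>\<in>space M. \<forall>i\<in>I. exp (- c) < exp (- X i \<omega>)}"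
    by simp
  also have "\<dots> = measure M2 {\<omega>\<in>space M2. \<forall>i\<in>I. exp (- c) < exp (- max 0 (\<omega> i))}"
    by (rule EM.box_prob_eq)
  \<comment> \<open>For \<open>c > 0\<close> the conditions \<open>max 0 x < c\<close> and
    \<open>x < c\<close> are equivalent.\<close>
  also have "{\<omega>\<in>space M2. \<forall>i\<in>I. exp (- c) < exp (- max 0 (\<omega> i))} = PiE I (\<lambda>_. {..<c})"
    unfolding space_M2 using c by (auto simp: PiE_iff extensional_def)
  finally have "ennreal (measure M {\<omega>\<in>space M. \<forall>i\<in>I. X i \<omega> < c}) = emeasure M2 (PiE I (\<lambda>_. {..<c}))"
    by (simp add: M2.emeasure_eq_measure)
  also have "\<dots> = (\<integral>\<^sup>+w. emeasure (N w) (PiE I (\<lambda>_. {..<c})) \<partial>\<mu>)"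
    unfolding M2_def using I by (intro emeasure_bind[OF _ N_sub]) (auto intro!: sets_PiM_I_finite)
  also have "\<dots> \<le> (\<integral>\<^sup>+w. ennreal (measure (gamma_measure a) {..<c} ^ card I) \<partial>\<mu>)"
  proof (rule nn_integral_mono)
    fix w
    interpret gw: product_prob_space "g w" I
      by (intro product_prob_space.intro product_prob_space_axioms.intro product_sigma_finite.intro g
          prob_space_imp_sigma_finite)
    have "emeasure (N w) (PiE I (\<lambda>_. {..<c})) = (\<Prod>i\<in>I. emeasure (g w i) {..<c})"
      unfolding N_def using I by (intro gw.emeasure_PiM) auto
    also have "\<dots> \<le> (\<Prod>i\<in>I. ennreal (measure (gamma_measure a) {..<c}))"
    proof (rule prod_mono_ennreal)
      fix i
      show "emeasure (g w i) {..<c} \<le> ennreal (measure (gamma_measure a) {..<c})"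
        unfolding finite_measure.emeasure_eq_measure[OF prob_space.finite_measure[OF g]] unfolding g_def
        using gamma_measure_shape_mono[OF a _ c] by (intro ennreal_leI) simp
    qed
    also have "\<dots> = ennreal (measure (gamma_measure a) {..<c} ^ card I)" by (simp add: ennreal_power)
    finally show "emeasure (N w) (PiE I (\<lambda>_. {..<c})) \<le> \<dots>" .
  qed
  also have "\<dots> = ennreal (measure (gamma_measure a) {..<c} ^ card I)"
    by (simp add: measure_pmf.emeasure_space_1)
  finally show ?thesis by (simp add: ennreal_le_iff)
qed

section \<open>The comparison theorem\<close>

text \<open>Sorting preserves the number of entries below a bound, and the first \<open>k\<close>
  sorted entries are at most the \<open>k\<close>-th. Ties can make the count larger than
  \<open>k\<close>.\<close>

lemma card_le_sort_nth:
  fixes xs :: "'a :: linorder list"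
  assumes "1 \<le> k" "k \<le> length xs"
  shows "k \<le> card {i. i < length xs \<and> xs ! i \<le> sort xs ! (k - 1)}"
proof -
  let ?P = "\<lambda>x. x \<le> sort xs ! (k - 1)"
  have "{..<k} \<subseteq> {i. i < length (sort xs) \<and> ?P (sort xs ! i)}"
    using assms by (auto intro!: sorted_nth_mono)
  then have "k \<le> card {i. i < length (sort xs) \<and> ?P (sort xs ! i)}"
    using card_mono[of "{i. i < length (sort xs) \<and> ?P (sort xs ! i)}" "{..<k}"] by simp
  also have "\<dots> = length (filter ?P (sort xs))" by (rule length_filter_conv_card[symmetric])
  also have "\<dots> = length (filter ?P xs)" by (simp only: filter_sort length_sort)
  also have "\<dots> = card {i. i < length xs \<and> ?P (xs ! i)}" by (rule length_filter_conv_card)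
  finally show ?thesis .
qed

section \<open>Kernel matrices of the process\<close>

context transient_process_with_local_times
begin

text \<open>Row \<open>i\<close> is \<open>kernel_row\<close> for the first visit from
  \<open>ts ! i\<close> to the other points of the list. The starting point is not among the
  targets, hence the zero diagonal of \<open>h\<close>.\<close>

lemma kernel_matrix_M_matrix:
  assumes ts: "distinct ts" "set ts \<subseteq> topspace S" and n: "length ts = n"
  shows "\<exists>(d :: nat \<Rightarrow> real) h. (\<forall>i<n. 0 < d i) \<and> (\<forall>i j. 0 \<le> h i j) \<and> (\<forall>i. h i i = 0) \<and>
    (\<forall>i<n. 0 < u (ts ! i) (ts ! i)) \<and>
    (\<forall>i<n. \<forall>k<n. u (ts ! i) (ts ! k) - (\<Sum>j<n. h i j * u (ts ! j) (ts ! k)) = (if i = k then d i else 0))"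
proof -
  let ?B = "\<lambda>i. set ts - {ts ! i}"
  let ?row = "\<lambda>i d h. i < n \<longrightarrow> 0 < d \<and> (\<forall>b. 0 \<le> h b) \<and>
      (\<forall>y\<in>?B i. u (ts ! i) y = (\<Sum>b\<in>?B i. h b * u b y)) \<and>
      u (ts ! i) (ts ! i) = d + (\<Sum>b\<in>?B i. h b * u b (ts ! i))"
  have "\<forall>i. \<exists>d h. ?row i d h"
  proof
    fix i
    show "\<exists>d h. ?row i d h"
    proof (cases "i < n")
      case True
      have B: "finite (?B i)" "?B i \<subseteq> topspace S" "ts ! i \<in> topspace S" "ts ! i \<notin> ?B i"
        using ts n True by auto
      show ?thesis
      proof (rule kernel_row[OF B])
        fix d h
        assume "0 < d" "\<And>b. 0 \<le> h b" "\<And>y. y \<in> ?B i \<Longrightarrow> u (ts ! i) y = (\<Sum>b\<in>?B i. h b * u b y)"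
          "u (ts ! i) (ts ! i) = d + (\<Sum>b\<in>?B i. h b * u b (ts ! i))"
        then have "?row i d h" by simp
        then show "\<exists>d h. ?row i d h" by (intro exI)
      qed
    qed simp
  qed
  then obtain d where "\<forall>i. \<exists>h. ?row i (d i) h" by (rule choice[THEN exE])
  then obtain h where "\<forall>i. ?row i (d i) (h i)" by (rule choice[THEN exE])
  then have dh: "\<And>i. i < n \<Longrightarrow> 0 < d i" "\<And>i b. i < n \<Longrightarrow> 0 \<le> h i b"
    "\<And>i y. i < n \<Longrightarrow> y \<in> ?B i \<Longrightarrow> u (ts ! i) y = (\<Sum>b\<in>?B i. h i b * u b y)"
    "\<And>i. i < n \<Longrightarrow> u (ts ! i) (ts ! i) = d i + (\<Sum>b\<in>?B i. h i b * u b (ts ! i))"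
    by simp_all
  have tsS: "ts ! j \<in> topspace S" if "j < n" for j using that ts(2) n by auto
  \<comment> \<open>Rows beyond \<open>n\<close> are set to 0 so that nonnegativity holds for all
    indices.\<close>
  define H where "H i j = (if i = j \<or> n \<le> i then 0 else h i (ts ! j))" for i j
  have sum: "(\<Sum>j<n. H i j * u (ts ! j) y) = (\<Sum>b\<in>?B i. h i b * u b y)" if i: "i < n" for i y
  proof -
    have "bij_betw (\<lambda>j. ts ! j) ({..<n} - {i}) (?B i)"
    proof (rule bij_betw_DiffI)
      show "bij_betw (\<lambda>j. ts ! j) {..<n} (set ts)"
        using ts(1) n by (auto intro!: bij_betw_nth)
      show "bij_betw (\<lambda>j. ts ! j) {i} {ts ! i}" by simp
    qed (use i n in auto)
    then have "(\<Sum>b\<in>?B i. h i b * u b y) = (\<Sum>j\<in>{..<n} - {i}. h i (ts ! j) * u (ts ! j) y)"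
      by (rule sum.reindex_bij_betw[symmetric])
    also have "\<dots> = (\<Sum>j\<in>{..<n} - {i}. H i j * u (ts ! j) y)"
      using i by (intro sum.cong) (auto simp: H_def)
    also have "\<dots> = (\<Sum>j<n. H i j * u (ts ! j) y)"
      by (rule sum.mono_neutral_left) (auto simp: H_def)
    finally show ?thesis ..
  qed
  show ?thesis
  proof (intro exI[of _ d] exI[of _ H] conjI allI impI)
    show "0 < d i" if "i < n" for i using dh(1)[OF that] .
    show nn: "0 \<le> H i j" for i j using dh(2) by (simp add: H_def)
    show "H i i = 0" for i by (simp add: H_def)
    fix i assume i: "i < n"
    have "0 \<le> (\<Sum>j<n. H i j * u (ts ! j) (ts ! i))"
      using nn i by (intro sum_nonneg mult_nonneg_nonneg u_nonneg tsS) auto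
    then show "0 < u (ts ! i) (ts ! i)" using dh(4)[OF i] dh(1)[OF i] sum[OF i] by simp
    fix k assume k: "k < n"
    show "u (ts ! i) (ts ! k) - (\<Sum>j<n. H i j * u (ts ! j) (ts ! k)) = (if i = k then d i else 0)"
    proof (cases "i = k")
      case True
      then show ?thesis using dh(4)[OF i] sum[OF i] by simp
    next
      case False
      then have "ts ! k \<in> ?B i" using i k ts(1) n by (auto simp: nth_eq_iff_index_eq)
      from dh(3)[OF i this] show ?thesis using False sum[OF i] by simp
    qed
  qed
qed

end

text \<open>The matrix \<open>diag (1 / d) (I - h)\<close> is a left inverse, hence for square
  matrices the inverse, and \<open>h\<close> has zero diagonal.\<close>

lemma diag_mat_inverse:
  fixes K h :: "nat \<Rightarrow> nat \<Rightarrow> real"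
  assumes d: "\<And>i. i < n \<Longrightarrow> d i \<noteq> 0" and h0: "\<And>i. h i i = 0"
    and hK: "\<And>i k. i < n \<Longrightarrow> k < n \<Longrightarrow> K i k - (\<Sum>j<n. h i j * K j k) = (if i = k then d i else 0)"
  shows "diag_mat (the (mat_inverse (Matrix.mat n n (\<lambda>(i, j). K i j)))) = map (\<lambda>i. 1 / d i) [0..<n]"
proof -
  let ?K = "Matrix.mat n n (\<lambda>(i, j). K i j)"
  define R where "R = Matrix.mat n n (\<lambda>(i, j). ((if i = j then 1 else 0) - h i j) / d i)"
  have car: "?K \<in> carrier_mat n n" "R \<in> carrier_mat n n" by (auto simp: R_def)
  have RK: "R * ?K = 1\<^sub>m n"
  proof (rule eq_matI)
    fix i k assume "i < dim_row (1\<^sub>m n :: real Matrix.mat)" "k < dim_col (1\<^sub>m n :: real Matrix.mat)"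
    then have ik: "i < n" "k < n" by auto
    have "(R * ?K) $$ (i, k) = (\<Sum>j<n. ((if i = j then 1 else 0) - h i j) / d i * K j k)"
      using ik by (simp add: R_def scalar_prod_def atLeast0LessThan)
    also have "\<dots> = (\<Sum>j<n. (if i = j then K i k / d i else 0) - h i j * K j k / d i)"
      by (intro sum.cong) (auto simp: diff_divide_distrib left_diff_distrib)
    also have "\<dots> = (K i k - (\<Sum>j<n. h i j * K j k)) / d i"
      using ik by (simp add: sum_subtractf sum_divide_distrib diff_divide_distrib)
    also have "\<dots> = (1\<^sub>m n) $$ (i, k)"
      unfolding hK[OF ik] using ik d by simp
    finally show "(R * ?K) $$ (i, k) = (1\<^sub>m n) $$ (i, k)" .
  qed (auto simp: R_def)
  have KR: "?K * R = 1\<^sub>m n" by (rule mat_mult_left_right_inverse[OF car(2,1) RK])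
  have "?K \<in> Units (ring_mat TYPE(real) n ())"
    using car RK KR by (auto simp: Units_def ring_mat_def)
  then obtain B where B: "mat_inverse ?K = Some B"
    using mat_inverse(1)[OF car(1), of "()"] by (cases "mat_inverse ?K") auto
  from mat_inverse(2)[OF car(1) B] have B': "B * ?K = 1\<^sub>m n" "B \<in> carrier_mat n n" by auto
  have "B = B * (?K * R)" unfolding KR using B' by simp
  also have "\<dots> = (B * ?K) * R" using B' car by (intro assoc_mult_mat[symmetric]) auto
  also have "\<dots> = R" unfolding B' using car by simp
  finally have "diag_mat (the (mat_inverse ?K)) = diag_mat R" using B by simp
  also have "\<dots> = map (\<lambda>i. 1 / d i) [0..<n]"
    using h0 by (auto simp: diag_mat_def R_def)
  finally show ?thesis .
qed

context transient_process_with_local_times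
begin

text \<open>If the supremum is below \<open>lam / a\<close> with \<open>a = a_star u ts k\<close>,
  then every index with \<open>1 / d i \<le> a\<close> has \<open>X (ts ! i) / d i < lam\<close>.
  There are at least \<open>k\<close> such indices, and \<open>gamma_mixture_box_le\<close> bounds
  the probability that all of them satisfy this.\<close>

lemma sup_permanental_ge:
  assumes T: "countable T" "topspace S = T" and perm: "permanental_process M T \<alpha> u X"
    and ts: "distinct ts" "set ts \<subseteq> T" and k: "1 \<le> k" "k \<le> length ts" and lam: "0 < lam"
  shows "1 - measure (gamma_measure \<alpha>) {..<lam} ^ k \<le>
    measure M {\<omega>\<in>space M. (SUP t\<in>T. ennreal (X t \<omega>)) \<ge> ennreal lam / ennreal (a_star u ts k)}"
proof -
  have \<alpha>: "0 < \<alpha>" and M: "prob_space M" and X: "\<And>t. t \<in> T \<Longrightarrow> X t \<in> borel_measurable M"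
    and X_nonneg: "\<And>t \<omega>. t \<in> T \<Longrightarrow> \<omega> \<in> space M \<Longrightarrow> 0 \<le> X t \<omega>"
    using perm by (simp_all add: permanental_process_def)
  have "\<forall>ts (s :: nat \<Rightarrow> real). set ts \<subseteq> T \<and> (\<forall>i<length ts. 0 \<le> s i) \<longrightarrow>
        (LINT \<omega>|M. exp (- (\<Sum>i<length ts. s i * X (ts ! i) \<omega>)))
          = Determinant.det (1\<^sub>m (length ts) + kernel_matrix u ts * mat_diag (length ts) s) powr (- \<alpha>)"
    using perm unfolding permanental_process_def by (elim conjE)
  note lt = this[rule_format, OF conjI]
  interpret M: prob_space M by (rule M)
  interpret Ga: prob_space "gamma_measure \<alpha>" by (rule prob_space_gamma_measure[OF \<alpha>])
  define n where "n = length ts"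
  obtain d h where d: "\<And>i. i < n \<Longrightarrow> 0 < d i" and h: "\<And>i j. 0 \<le> h i j" "\<And>i. h i i = 0"
    and uii: "\<And>i. i < n \<Longrightarrow> 0 < u (ts ! i) (ts ! i)"
    and hK: "\<And>i k. i < n \<Longrightarrow> k < n \<Longrightarrow>
      u (ts ! i) (ts ! k) - (\<Sum>j<n. h i j * u (ts ! j) (ts ! k)) = (if i = k then d i else 0)"
    using kernel_matrix_M_matrix[OF ts(1) ts(2)[folded T(2)] n_def[symmetric]] by blast
  have tsT: "ts ! i \<in> T" if "i < n" for i using that ts(2) n_def by auto
  have km: "kernel_matrix u ts = Matrix.mat n n (\<lambda>(i, j). u (ts ! i) (ts ! j))"
    by (simp add: kernel_matrix_def n_def)
  define as where "as = map (\<lambda>i. 1 / d i) [0..<n]"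
  have diag: "diag_mat (the (mat_inverse (kernel_matrix u ts))) = as"
    unfolding km as_def
  proof (rule diag_mat_inverse[OF _ h(2) hK])
    show "d i \<noteq> 0" if "i < n" for i using d[OF that] by simp
  qed
  define a where "a = a_star u ts k"
  have a_sort: "a = sort as ! (k - 1)" by (simp add: a_def a_star_def diag)
  have "a \<in> set (sort as)"
    unfolding a_sort by (rule nth_mem) (use k in \<open>auto simp: as_def n_def\<close>)
  then have a: "0 < a" using d by (auto simp: as_def)
  define J where "J = {i. i < n \<and> 1 / d i \<le> a}"
  have J: "finite J" "\<And>i. i \<in> J \<Longrightarrow> i < n" by (auto simp: J_def)
  have "k \<le> card {i. i < length as \<and> as ! i \<le> sort as ! (k - 1)}"
    using k by (intro card_le_sort_nth) (auto simp: as_def n_def)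
  also have "{i. i < length as \<and> as ! i \<le> sort as ! (k - 1)} = J"
    unfolding a_sort[symmetric] J_def by (auto simp: as_def)
  finally have card_J: "k \<le> card J" .
  obtain \<mu> :: "nat list pmf" where \<mu>: "\<And>s. (\<And>i. i < n \<Longrightarrow> 0 \<le> s i) \<Longrightarrow>
      ennreal (Determinant.det (1\<^sub>m n + Matrix.mat n n (\<lambda>(i, j). u (ts ! i) (ts ! j)) * mat_diag n s) powr (- \<alpha>)) =
      (\<integral>\<^sup>+w. ennreal (\<Prod>i<n. (1 + s i * d i) powr (- (\<alpha> + count_list w i))) \<partial>\<mu>)"
    by (rule permanental_mixture[of n h "\<lambda>i j. u (ts ! i) (ts ! j)" d \<alpha>])
       (use h u_nonneg uii d hK \<alpha> tsT T(2) in auto)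
  have "measure M {\<omega>\<in>space M. \<forall>i\<in>J. X (ts ! i) \<omega> / d i < lam} \<le> measure (gamma_measure \<alpha>) {..<lam} ^ card J"
  proof (rule gamma_mixture_box_le[where \<mu>=\<mu>])
    show "prob_space M" "finite J" "0 < \<alpha>" "0 < lam" by (fact M J \<alpha> lam)+
    show "(\<lambda>\<omega>. X (ts ! i) \<omega> / d i) \<in> borel_measurable M" if "i \<in> J" for i
      using X[OF tsT[OF J(2)[OF that]]] by measurable
    show "0 \<le> X (ts ! i) \<omega> / d i" if "i \<in> J" "\<omega> \<in> space M" for i \<omega>
      using X_nonneg[OF tsT] J(2) d that by (intro divide_nonneg_pos) auto
    fix s :: "nat \<Rightarrow> real" assume s: "\<And>i. i \<in> J \<Longrightarrow> 0 \<le> s i"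
    \<comment> \<open>Zeros outside \<open>J\<close> select the marginal on \<open>J\<close>; the
      division by \<open>d i\<close> accounts for the rescaling of the coordinates.\<close>
    define s' where "s' i = (if i \<in> J then s i / d i else 0)" for i
    have s': "0 \<le> s' i" if "i < n" for i
      using s d[OF that] by (simp add: s'_def)
    have "(\<Sum>i\<in>J. s i * (X (ts ! i) \<omega> / d i)) = (\<Sum>i<n. s' i * X (ts ! i) \<omega>)" for \<omega>
    proof -
      have "(\<Sum>i<n. s' i * X (ts ! i) \<omega>) = (\<Sum>i\<in>J. s' i * X (ts ! i) \<omega>)"
        by (rule sum.mono_neutral_right) (auto simp: J(2) s'_def)
      then show ?thesis by (simp add: s'_def)
    qed
    then have "ennreal (LINT \<omega>|M. exp (- (\<Sum>i\<in>J. s i * (X (ts ! i) \<omega> / d i)))) =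
        (\<integral>\<^sup>+w. ennreal (\<Prod>i<n. (1 + s' i * d i) powr (- (\<alpha> + count_list w i))) \<partial>\<mu>)"
      using lt[of ts s'] ts(2) s' \<mu>[of s'] by (simp add: n_def[symmetric] km)
    moreover have "(\<Prod>i<n. (1 + s' i * d i) powr (- (\<alpha> + count_list w i))) =
        (\<Prod>i\<in>J. (1 + s i) powr (- (\<alpha> + real (count_list w i))))" for w
    proof -
      have "(\<Prod>i<n. (1 + s' i * d i) powr (- (\<alpha> + count_list w i))) =
          (\<Prod>i\<in>J. (1 + s' i * d i) powr (- (\<alpha> + count_list w i)))"
        by (rule prod.mono_neutral_right) (auto simp: J(2) s'_def)
      also have "\<dots> = (\<Prod>i\<in>J. (1 + s i) powr (- (\<alpha> + real (count_list w i))))"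
        using d J(2) by (intro prod.cong) (force simp: s'_def)+
      finally show ?thesis .
    qed
    ultimately show "ennreal (LINT \<omega>|M. exp (- (\<Sum>i\<in>J. s i * (X (ts ! i) \<omega> / d i)))) =
        (\<integral>\<^sup>+w. ennreal (\<Prod>i\<in>J. (1 + s i) powr (- (\<alpha> + real (count_list w i)))) \<partial>\<mu>)" by (simp only:)
  qed
  \<comment> \<open>Through ties \<open>J\<close> can have more than \<open>k\<close> elements; the
    additional factors are at most 1.\<close>
  also have "\<dots> \<le> measure (gamma_measure \<alpha>) {..<lam} ^ k"
    using card_J by (intro power_decreasing) auto
  finally have box: "measure M {\<omega>\<in>space M. \<forall>i\<in>J. X (ts ! i) \<omega> / d i < lam} \<le> measure (gamma_measure \<alpha>) {..<lam} ^ k" .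
  let ?E = "{\<omega>\<in>space M. (SUP t\<in>T. ennreal (X t \<omega>)) \<ge> ennreal lam / ennreal a}"
  have [measurable]: "(\<lambda>\<omega>. SUP t\<in>T. ennreal (X t \<omega>)) \<in> borel_measurable M"
    using X by (intro borel_measurable_SUP[OF T(1)]) simp
  have E: "?E \<in> sets M" by measurable
  have "space M - ?E \<subseteq> {\<omega>\<in>space M. \<forall>i\<in>J. X (ts ! i) \<omega> / d i < lam}"
  proof (intro subsetI CollectI conjI ballI)
    fix \<omega> i assume \<omega>: "\<omega> \<in> space M - ?E" and i: "i \<in> J"
    have nn: "0 \<le> X (ts ! i) \<omega>" using \<omega> J(2)[OF i] by (intro X_nonneg tsT) blast+
    have not: "\<not> ennreal lam / ennreal a \<le> (SUP t\<in>T. ennreal (X t \<omega>))" using \<omega> by blast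
    have "ennreal (X (ts ! i) \<omega>) \<le> (SUP t\<in>T. ennreal (X t \<omega>))"
      by (rule SUP_upper[OF tsT[OF J(2)[OF i]]])
    also have "\<dots> < ennreal lam / ennreal a" using not by (simp only: not_le)
    also have "\<dots> = ennreal (lam / a)" using lam a by (simp add: divide_ennreal)
    finally have "X (ts ! i) \<omega> < lam / a"
      using nn by (simp only: ennreal_less_iff)
    then have "X (ts ! i) \<omega> * a < lam" using a by (simp add: field_simps)
    moreover have "X (ts ! i) \<omega> * (1 / d i) \<le> X (ts ! i) \<omega> * a"
      using nn i by (intro mult_left_mono) (auto simp: J_def)
    ultimately show "X (ts ! i) \<omega> / d i < lam" by simp
  qed blast
  then have "measure M (space M - ?E) \<le> measure M {\<omega>\<in>space M. \<forall>i\<in>J. X (ts ! i) \<omega> / d i < lam}"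
  proof (rule M.finite_measure_mono)
    have "{\<omega>\<in>space M. X (ts ! i) \<omega> / d i < lam} \<in> sets M" if "i \<in> J" for i
    proof -
      have "(\<lambda>\<omega>. X (ts ! i) \<omega> / d i) \<in> borel_measurable M"
        using X[OF tsT[OF J(2)[OF that]]] by measurable
      then show ?thesis by (rule borel_measurable_less[OF _ borel_measurable_const])
    qed
    then show "{\<omega>\<in>space M. \<forall>i\<in>J. X (ts ! i) \<omega> / d i < lam} \<in> sets M"
      by (rule sets.sets_Collect_finite_All[OF _ J(1)])
  qed
  with box have "1 - measure M ?E \<le> measure (gamma_measure \<alpha>) {..<lam} ^ k"
    unfolding M.prob_compl[OF E] by linarith
  then show ?thesis unfolding a_def by linarith
qed

end

section \<open>The maximum of gamma variables and the infimum over tuples\<close>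

lemma prob_Max_ge:
  assumes "prob_space N" "prob_space.indep_vars N (\<lambda>_. borel) \<xi> {1..}"
    and dist: "\<And>i. 1 \<le> i \<Longrightarrow> distributed N lborel (\<xi> i) (\<lambda>x. ennreal (gamma_density \<alpha> x))"
    and k: "1 \<le> (k :: nat)"
  shows "measure N {\<omega>\<in>space N. Max ((\<lambda>i. \<xi> i \<omega>) ` {1..k}) \<ge> lam} = 1 - measure (gamma_measure \<alpha>) {..<lam} ^ k"
proof -
  interpret N: prob_space N by fact
  have [measurable]: "\<xi> i \<in> borel_measurable N" if "i \<in> {1..k}" for i
    using distributed_measurable[OF dist[of i]] that by simp
  let ?E = "{\<omega>\<in>space N. \<forall>i\<in>{1..k}. \<xi> i \<omega> < lam}"
  have "measure N ?E = measure N (\<Inter>i\<in>{1..k}. \<xi> i -` {..<lam} \<inter> space N)"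
    using k by (intro arg_cong[where f="measure N"]) auto
  also have "\<dots> = (\<Prod>i\<in>{1..k}. measure N (\<xi> i -` {..<lam} \<inter> space N))"
    using k by (intro N.indep_varsD[OF assms(2)]) auto
  also have "\<dots> = (\<Prod>i\<in>{1..k}. measure (gamma_measure \<alpha>) {..<lam})"
  proof (rule prod.cong[OF refl])
    fix i assume i: "i \<in> {1..k}"
    have "gamma_measure \<alpha> = distr N lborel (\<xi> i)"
      using distributed_distr_eq_density[OF dist[of i]] i by simp
    then show "measure N (\<xi> i -` {..<lam} \<inter> space N) = measure (gamma_measure \<alpha>) {..<lam}"
      using distributed_measurable[OF dist[of i]] i by (simp add: measure_distr)
  qed
  finally have E: "measure N ?E = measure (gamma_measure \<alpha>) {..<lam} ^ k" by simp
  have "{\<omega>\<in>space N. Max ((\<lambda>i. \<xi> i \<omega>) ` {1..k}) \<ge> lam} = space N - ?E"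
    using k by (auto simp: Max_ge_iff not_less)
  moreover have "?E \<in> sets N" by measurable
  ultimately show ?thesis using N.prob_compl[of ?E] E by simp
qed

lemma ennreal_inverse_antimono:
  fixes a b :: ennreal
  assumes "a \<le> b"
  shows "inverse b \<le> inverse a"
proof (cases "a = 0 \<or> b = \<top>")
  case False
  then obtain x y where "a = ennreal x" "b = ennreal y" "0 < x" "0 < y" "x \<le> y"
    using assms by (cases a; cases b) (auto simp: top_unique)
  then show ?thesis by (simp add: inverse_ennreal ennreal_leI)
qed auto

text \<open>The infimum need not be attained. Along values decreasing to it the thresholds increase
  to \<open>c / (INF i\<in>A. g i)\<close>, so the events decrease to the desired one and continuity
  from above preserves the lower bound. An infimum of 0 is covered because inversion is continuous
  on \<open>ennreal\<close>.\<close>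

lemma measure_ge_divide_INF:
  fixes Z :: "'b \<Rightarrow> ennreal" and g :: "'i \<Rightarrow> ennreal"
  assumes "prob_space M" and [measurable]: "Z \<in> borel_measurable M" and q: "q \<le> 1" and c: "c < \<top>"
    and le: "\<And>i. i \<in> A \<Longrightarrow> q \<le> measure M {\<omega>\<in>space M. c / g i \<le> Z \<omega>}"
  shows "q \<le> measure M {\<omega>\<in>space M. c / (INF i\<in>A. g i) \<le> Z \<omega>}"
proof (cases "A = {}")
  case True
  interpret M: prob_space M by fact
  \<comment> \<open>The infimum over the empty set is \<open>\<top>\<close>, so the threshold is 0
    and the event is the whole space.\<close>
  have "{\<omega>\<in>space M. c / (INF i\<in>A. g i) \<le> Z \<omega>} = space M" using True c by simp
  then show ?thesis using q M.prob_space by simp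
next
  case False
  interpret M: prob_space M by fact
  obtain f :: "nat \<Rightarrow> ennreal" where f: "decseq f" "range f \<subseteq> g ` A" "(INF i\<in>A. g i) = (INF j. f j)"
    using ennreal_Inf_countable_INF[of "g ` A"] False by auto
  define E where "E r = {\<omega>\<in>space M. c / r \<le> Z \<omega>}" for r
  have E: "E r \<in> sets M" for r unfolding E_def by measurable
  have mono: "c / r \<le> c / r'" if "r' \<le> r" for r r' :: ennreal
    unfolding divide_ennreal_def by (intro mult_left_mono ennreal_inverse_antimono that) simp
  have lim: "(\<lambda>j. c / f j) \<longlonglongrightarrow> c / (INF j. f j)"
  proof -
    have "(\<lambda>j. inverse (f j)) \<longlonglongrightarrow> inverse (INF j. f j)"
      by (rule continuous_on_tendsto_compose[OF continuous_on_inverse_ennreal[OF continuous_on_id, of UNIV] LIMSEQ_INF[OF f(1)]]) auto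
    then show ?thesis unfolding divide_ennreal_def by (rule ennreal_tendsto_cmult[OF c])
  qed
  have "(\<lambda>j. measure M (E (f j))) \<longlonglongrightarrow> measure M (\<Inter>j. E (f j))"
  proof (rule M.finite_Lim_measure_decseq)
    show "decseq (\<lambda>j. E (f j))"
      unfolding decseq_def
    proof (intro allI impI)
      fix m n :: nat assume "m \<le> n"
      then have "c / f m \<le> c / f n" using f(1) by (intro mono) (simp add: decseq_def)
      then show "E (f n) \<subseteq> E (f m)" unfolding E_def by (blast intro: order_trans)
    qed
  qed (use E in auto)
  moreover have "(\<Inter>j. E (f j)) = E (INF j. f j)"
  proof
    show "(\<Inter>j. E (f j)) \<subseteq> E (INF j. f j)"
      unfolding E_def using LIMSEQ_le_const2[OF lim] by blast
    show "E (INF j. f j) \<subseteq> (\<Inter>j. E (f j))"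
    proof (rule INT_greatest)
      fix j
      have "c / f j \<le> c / (INF j. f j)" by (intro mono INF_lower) simp
      then show "E (INF j. f j) \<subseteq> E (f j)" unfolding E_def by (blast intro: order_trans)
    qed
  qed
  moreover have "q \<le> measure M (E (f j))" for j
  proof -
    obtain i where "i \<in> A" "f j = g i" using f(2) by auto
    then show ?thesis using le unfolding E_def by simp
  qed
  ultimately have "q \<le> measure M (E (INF j. f j))"
    using LIMSEQ_le_const[of "\<lambda>j. measure M (E (f j))"] by auto
  then show ?thesis unfolding f(3) E_def .
qed

theorem lemma1p1:
  fixes T :: "'a set"
    and \<alpha> lam :: real
    and u :: "'a \<Rightarrow> 'a \<Rightarrow> real"
    and M :: "'b measure"
    and X :: "'a \<Rightarrow> 'b \<Rightarrow> real"
    and G :: "'w measure"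
    and F :: "real \<Rightarrow> 'w measure"
    and S :: "'a topology"
    and Y :: "real \<Rightarrow> 'w \<Rightarrow> 'a option"
    and \<theta> :: "real \<Rightarrow> 'w \<Rightarrow> 'w"
    and P :: "'a option \<Rightarrow> 'w measure"
    and m :: "'a measure"
    and L :: "'a \<Rightarrow> real \<Rightarrow> 'w \<Rightarrow> real"
    and N :: "'c measure"
    and \<xi> :: "nat \<Rightarrow> 'c \<Rightarrow> real"
    and n p :: nat
  assumes "countable T"
    and "0 < \<alpha>"
    and "topspace S = T"
    and "transient_process_with_local_times G F S Y \<theta> P m L u"
    and "permanental_process M T \<alpha> u X"
    and "prob_space N"
    and "prob_space.indep_vars N (\<lambda>_. borel) \<xi> {1..}"
    and "\<And>i. 1 \<le> i \<Longrightarrow> distributed N lborel (\<xi> i) (\<lambda>x. ennreal (gamma_density \<alpha> x))"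
    and "1 \<le> p"
    and "p \<le> n"
    and "0 < lam"
  shows "measure M {\<omega>\<in>space M. (SUP t\<in>T. ennreal (X t \<omega>)) \<ge> ennreal lam / psi_star T u n (n div p)}
    \<ge> measure N {\<omega>\<in>space N. Max ((\<lambda>i. \<xi> i \<omega>) ` {1..n div p}) \<ge> lam}"
proof -
  interpret transient_process_with_local_times G F S Y \<theta> P m L u by fact
  have M: "prob_space M" and X: "\<And>t. t \<in> T \<Longrightarrow> X t \<in> borel_measurable M"
    using assms(5) unfolding permanental_process_def by auto
  \<comment> \<open>The lower bound keeps the set under \<open>Max\<close> nonempty and the position
    \<open>n div p - 1\<close> in \<open>a_star\<close> meaningful; the upper bound keeps that
    position inside the list.\<close>
  have k: "1 \<le> n div p" "n div p \<le> n"
    using assms(9,10) by (auto simp: Suc_le_eq div_greater_zero_iff)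
  have "measure N {\<omega>\<in>space N. Max ((\<lambda>i. \<xi> i \<omega>) ` {1..n div p}) \<ge> lam} =
      1 - measure (gamma_measure \<alpha>) {..<lam} ^ (n div p)"
    by (rule prob_Max_ge[OF assms(6-8) k(1)])
  \<comment> \<open>If \<open>T\<close> has fewer than \<open>n\<close> points there are no tuples;
    \<open>measure_ge_divide_INF\<close> includes this case.\<close>
  also have "\<dots> \<le> measure M {\<omega>\<in>space M. ennreal lam / psi_star T u n (n div p) \<le> (SUP t\<in>T. ennreal (X t \<omega>))}"
    unfolding psi_star_def
  proof (rule measure_ge_divide_INF[OF M])
    show "(\<lambda>\<omega>. SUP t\<in>T. ennreal (X t \<omega>)) \<in> borel_measurable M"
      using X by (intro borel_measurable_SUP[OF assms(1)]) simp
    fix ts assume "ts \<in> {ts. length ts = n \<and> distinct ts \<and> set ts \<subseteq> T}"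
    then show "1 - measure (gamma_measure \<alpha>) {..<lam} ^ (n div p) \<le>
        measure M {\<omega>\<in>space M. ennreal lam / ennreal (a_star u ts (n div p)) \<le> (SUP t\<in>T. ennreal (X t \<omega>))}"
      using k by (intro sup_permanental_ge assms) auto
  qed auto
  finally show ?thesis .
qed

end
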